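(* The exponent $1/2$ in the two inequalities $$\min_{z_0\in\mathbb C,\ |c|=1}\|f_U-c\,\varphi_{z_0}\|_{L^2(\mathbb R)}\le C e^{|U|/2}\Big(1-\tfrac{\lambda_1(U)}{1-e^{-|U|}}\Big)^{1/2},\qquad \mathcal A(U)\le K(|U|)\Big(1-\tfrac{\lambda_1(U)}{1-e^{-|U|}}\Big)^{1/2}$$ (valid for all measurable $U\subset\mathbb R^2$ of finite positive measure, with a constant $C>0$ and a function $K:(0,\infty)\to(0,\infty)$) is optimal: it cannot be replaced by any $\beta>1/2$. That is, for every $\beta>1/2$: (1) there is no constant $C>0$ such that $\min_{z_0\in\mathbb C,\,|c|=1}\|f_U-c\,\varphi_{z_0}\|_{L^2(\mathbb R)}\le C e^{|U|/2}\big(1-\tfrac{\lambda_1(U)}{1-e^{-|U|}}\big)^{\beta}$ for all measurable $U\subset\mathbb R^2$ of finite positive measure; (2) there is no function $K:(0,\infty)\to(0,\infty)$ such that $\mathcal A(U)\le K(|U|)\big(1-\tfrac{\lambda_1(U)}{1-e^{-|U|}}\big)^{\beta}$ for all measurable $U\subset\mathbb R^2$ of finite positive measure.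
   Context: Let $\varphi(t)=2^{1/4}e^{-\pi t^2}$ on $\mathbb R$ and $V_\varphi f(x,\omega)=\int_{\mathbb R}f(t)\overline{\varphi(t-x)}e^{-2\pi i t\omega}\,dt$ for $f\in L^2(\mathbb R)$. For measurable $U\subset\mathbb R^2$ of finite positive measure $|U|$, the localization operator $\mathcal L_U$ on $L^2(\mathbb R)$ is defined by $\langle\mathcal L_Uf,g\rangle=\int_U V_\varphi f\,\overline{V_\varphi g}\,dx\,d\omega$; it is compact, self-adjoint and positive. $\lambda_1(U)$ denotes its largest eigenvalue, and $f_U$ an $L^2$-normalized eigenfunction for $\lambda_1(U)$. For $z_0=x_0+i\omega_0\in\mathbb C$, $\varphi_{z_0}(t)=e^{2\pi i\omega_0 t}\varphi(t-x_0)$ is the Gaussian optimizer centred at $z_0$. The Fraenkel asymmetry is $\mathcal A(U)=\inf\{|U\triangle B|/|U| : B\subset\mathbb R^2\text{ a disk with }|B|=|U|\}$. *)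

theory Defs
  imports "HOL-Analysis.Analysis"
begin

text \<open>
  Elements of \<open>L\<^sup>2(\<real>)\<close> are represented by Lebesgue measurable functions \<open>real \<Rightarrow> complex\<close>;
  identification is almost everywhere.
\<close>

definition L2 :: "(real \<Rightarrow> complex) set" where
  "L2 = {f \<in> borel_measurable lebesgue. integrable lebesgue (\<lambda>t. (cmod (f t))\<^sup>2)}"

definition l2_inner :: "(real \<Rightarrow> complex) \<Rightarrow> (real \<Rightarrow> complex) \<Rightarrow> complex" where
  "l2_inner f g = (LINT t|lebesgue. f t * cnj (g t))"

definition l2_norm :: "(real \<Rightarrow> complex) \<Rightarrow> real" where
  "l2_norm f = sqrt (LINT t|lebesgue. (cmod (f t))\<^sup>2)"

definition gauss :: "real \<Rightarrow> complex" where
  "gauss t = complex_of_real (2 powr (1/4) * exp (- pi * t\<^sup>2))"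

definition gauss_at :: "complex \<Rightarrow> real \<Rightarrow> complex" where
  "gauss_at z t = exp (2 * pi * \<i> * Im z * t) * gauss (t - Re z)"

definition stft :: "(real \<Rightarrow> complex) \<Rightarrow> real \<times> real \<Rightarrow> complex" where
  "stft f = (\<lambda>(x, \<omega>). LINT t|lebesgue. f t * cnj (gauss (t - x)) * exp (- (2 * pi * \<i> * t * \<omega>)))"

definition admissible :: "(real \<times> real) set \<Rightarrow> bool" where
  "admissible U \<longleftrightarrow> U \<in> lmeasurable \<and> 0 < measure lebesgue U"

text \<open>
  The localization operator is given weakly, hence as a relation: \<open>loc_op U f h\<close> says that
  \<open>h\<close> is a representative of \<open>\<L>\<^sub>U f\<close>, which determines \<open>h\<close> up to null sets.
\<close>

definition loc_op :: "(real \<times> real) set \<Rightarrow> (real \<Rightarrow> complex) \<Rightarrow> (real \<Rightarrow> complex) \<Rightarrow> bool" where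
  "loc_op U f h \<longleftrightarrow> f \<in> L2 \<and> h \<in> L2 \<and>
     (\<forall>g\<in>L2. l2_inner h g = (LINT z:U|lebesgue. stft f z * cnj (stft g z)))"

definition loc_eigenfunction :: "(real \<times> real) set \<Rightarrow> complex \<Rightarrow> (real \<Rightarrow> complex) \<Rightarrow> bool" where
  "loc_eigenfunction U \<mu> f \<longleftrightarrow>
     f \<in> L2 \<and> \<not> (AE t in lebesgue. f t = 0) \<and> loc_op U f (\<lambda>t. \<mu> * f t)"

definition loc_eigenvalue :: "(real \<times> real) set \<Rightarrow> complex \<Rightarrow> bool" where
  "loc_eigenvalue U \<mu> \<longleftrightarrow> (\<exists>f. loc_eigenfunction U \<mu> f)"

text \<open>
  All eigenvalues are real by self-adjointness, and the largest one exists by compactness and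
  positivity.
\<close>

definition lambda1 :: "(real \<times> real) set \<Rightarrow> real" where
  "lambda1 U = (GREATEST r::real. loc_eigenvalue U (complex_of_real r))"

definition top_eigenfunction :: "(real \<times> real) set \<Rightarrow> (real \<Rightarrow> complex) \<Rightarrow> bool" where
  "top_eigenfunction U f \<longleftrightarrow>
     loc_eigenfunction U (complex_of_real (lambda1 U)) f \<and> l2_norm f = 1"

text \<open>The infimum below is a minimum for \<open>f \<in> L2\<close> with \<open>l2_norm f = 1\<close>.\<close>

definition gauss_dist :: "(real \<Rightarrow> complex) \<Rightarrow> real" where
  "gauss_dist f = Inf {l2_norm (\<lambda>t. f t - c * gauss_at z t) | z c. cmod c = 1}"

definition fraenkel_asymmetry :: "(real \<times> real) set \<Rightarrow> real" where
  "fraenkel_asymmetry U =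
     Inf {measure lebesgue (sym_diff U B) / measure lebesgue U | B.
           (\<exists>p r. B = ball p r) \<and> measure lebesgue B = measure lebesgue U}"

text \<open>
  The deficit is nonnegative, since \<open>lambda1 U \<le> 1 - exp (- \<bar>U\<bar>)\<close> (Faber--Krahn inequality
  for the short-time Fourier transform), so \<open>powr\<close> below is applied to nonnegative bases only.
\<close>

definition deficit :: "(real \<times> real) set \<Rightarrow> real" where
  "deficit U = 1 - lambda1 U / (1 - exp (- measure lebesgue U))"

definition eigenfunction_stability ::
    "((real \<times> real) set \<Rightarrow> real \<Rightarrow> complex) \<Rightarrow> real \<Rightarrow> real \<Rightarrow> bool" where
  "eigenfunction_stability F C \<beta> \<longleftrightarrow>
     (\<forall>U. admissible U \<longrightarrow>
        gauss_dist (F U) \<le> C * exp (measure lebesgue U / 2) * deficit U powr \<beta>)"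

definition set_stability :: "(real \<Rightarrow> real) \<Rightarrow> real \<Rightarrow> bool" where
  "set_stability K \<beta> \<longleftrightarrow>
     (\<forall>U. admissible U \<longrightarrow>
        fraenkel_asymmetry U \<le> K (measure lebesgue U) * deficit U powr \<beta>)"

end

theory Submission
  imports Defs "HOL-Probability.Characteristic_Functions" "HOL-Complex_Analysis.Complex_Analysis"
begin

text \<open>
  The two exponents are shown to be optimal by one family of domains of area \<open>1\<close>: the disc of area
  \<open>1\<close> is enlarged by a relative amount of size \<open>d\<close> inside a symmetric double cone and shrunk outside
  it. Along this family the deficit is \<open>O(d\<^sup>2)\<close>, while both the distance of the eigenfunction from the
  Gaussians and the Fraenkel asymmetry are at least a constant times \<open>d\<close>. For \<open>\<beta> > 1/2\<close> a bound by the
  deficit to the power \<open>\<beta>\<close> is of order \<open>d powr (2 * \<beta>)\<close>, which is smaller than \<open>d\<close> as \<open>d\<close> tends to \<open>0\<close>.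

  \<^bold>\<open>The deficit is quadratic.\<close> The largest eigenvalue is the maximum of the energy
  \<open>\<integral>\<^sub>U \<bar>V\<^sub>\<phi> f\<bar>\<^sup>2\<close> over unit vectors \<open>f\<close> (\<open>lambda1_maximal\<close>). For the Gaussian \<open>\<phi>\<close> this energy is the integral of
  \<open>exp (- \<pi> \<bar>z\<bar>\<^sup>2)\<close> over \<open>U\<close>. It differs from the value \<open>1 - exp (- 1)\<close> for the disc only by \<open>O(d\<^sup>2)\<close>,
  since the mass is moved across a boundary on which the weight is constant
  (\<open>gauss_energy_near_optimal\<close>). In the other direction, \<open>\<phi>\<close> is an eigenfunction for centred discs
  (\<open>stft_form_area_disc_gauss\<close>), so the operator of \<open>U\<close> couples \<open>\<phi>\<close> to its orthogonal complement with
  strength \<open>O(d)\<close>; the energy on that complement is smaller by a fixed gap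
  (\<open>stft_energy_orthogonal\<close>); and second-order perturbation theory bounds the eigenvalue from above up
  to \<open>O(d\<^sup>2)\<close> (\<open>stft_energy_upper_bound\<close>).

  \<^bold>\<open>The eigenfunction moves linearly.\<close> The domain is centrally symmetric, so by the gap its top
  eigenfunctions are even (\<open>eigenfunction_even\<close>). An even function close to a Gaussian is close to the
  one centred at the origin, which disposes of the minimization over centres
  (\<open>eigenfunction_distance\<close>). It remains to see that \<open>\<phi>\<close> fails the eigenvalue equation for \<open>U\<close> by at
  least a constant times \<open>d\<close>: tested against a combination of four atoms orthogonal to \<open>\<phi>\<close>, the operator
  only sees the lobes of \<open>U\<close>, where the integrand has a sign (\<open>cross_probe_detects_rim\<close>).

  \<^bold>\<open>The asymmetry is linear.\<close> A disc of area \<open>1\<close> with centre \<open>p\<close> contains no point of the half plane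
  \<open>z \<bullet> p \<le> 0\<close> outside the centred disc of area \<open>1\<close>, and so misses half of the lobes
  (\<open>fraenkel_asymmetry_lobed_disc\<close>).
\<close>

section \<open>Square integrable functions\<close>

text \<open>
  The choice \<open>\<tau> = - b / C\<close> completes the square. This single argument serves twice: for the inner
  product it is the Cauchy--Schwarz inequality, and for the form \<open>M \<langle>f, g\<rangle> - \<langle>\<L>\<^sub>U f, g\<rangle>\<close>, nonnegative when
  \<open>M\<close> is the top of the spectrum, it shows that maximizing sequences are almost eigenvectors.
\<close>

lemma psd_form_discriminant:
  fixes A C :: real and b :: complex
  assumes psd: "\<And>\<tau>::complex. 0 \<le> A + 2 * Re (cnj \<tau> * b) + (cmod \<tau>)\<^sup>2 * C"
    and C: "0 \<le> C"
  shows "(cmod b)\<^sup>2 \<le> A * C"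
proof (cases "C = 0")
  case True
  show ?thesis
  proof (cases "b = 0")
    case False
    define s where "s = (\<bar>A\<bar> + 1) / (cmod b)\<^sup>2"
    have "Re (cnj (- of_real s * b) * b) = - s * (cmod b)\<^sup>2"
      by (simp add: cmod_power2) (simp add: power2_eq_square algebra_simps)
    also have "\<dots> = - (\<bar>A\<bar> + 1)" using False by (simp add: s_def)
    finally have "Re (cnj (- of_real s * b) * b) = - (\<bar>A\<bar> + 1)" .
    with psd[of "- of_real s * b"] True show ?thesis by simp
  qed (use True in simp)
next
  case False
  then have C: "C > 0" using C by simp
  have r1: "Re (cnj (- b / of_real C) * b) = - (cmod b)\<^sup>2 / C"
    using C by (simp add: cmod_power2) (simp add: power2_eq_square field_simps)
  have r2: "(cmod (- b / of_real C))\<^sup>2 * C = (cmod b)\<^sup>2 / C"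
    using C by (simp add: norm_divide power_divide power2_eq_square)
  have "0 \<le> A - (cmod b)\<^sup>2 / C"
    using psd[of "- b / of_real C"] unfolding r1 r2 by simp
  then show ?thesis using C by (simp add: field_simps)
qed

lemma L2_measurable: "f \<in> L2 \<Longrightarrow> f \<in> borel_measurable lebesgue"
  by (simp add: L2_def)

lemma L2_integrable_mult:
  assumes "f \<in> L2" "g \<in> L2"
  shows "integrable lebesgue (\<lambda>t. f t * cnj (g t))"
proof (rule Bochner_Integration.integrable_bound)
  show "integrable lebesgue (\<lambda>t. (cmod (f t))\<^sup>2 + (cmod (g t))\<^sup>2)"
    using assms by (auto simp: L2_def)
  have "cnj \<in> borel_measurable borel"
    by (intro borel_measurable_continuous_onI continuous_intros)
  then show "(\<lambda>t. f t * cnj (g t)) \<in> borel_measurable lebesgue"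
    using assms L2_measurable by measurable
  show "AE t in lebesgue. norm (f t * cnj (g t)) \<le> norm ((cmod (f t))\<^sup>2 + (cmod (g t))\<^sup>2)"
  proof (rule AE_I2)
    fix t
    have "2 * (cmod (f t) * cmod (g t)) \<le> (cmod (f t))\<^sup>2 + (cmod (g t))\<^sup>2"
      using sum_squares_bound[of "cmod (f t)" "cmod (g t)"] by simp
    moreover have "0 \<le> cmod (f t) * cmod (g t)" by simp
    ultimately show "norm (f t * cnj (g t)) \<le> norm ((cmod (f t))\<^sup>2 + (cmod (g t))\<^sup>2)"
      unfolding norm_mult complex_mod_cnj real_norm_def by linarith
  qed
qed

lemma L2_scale [simp, intro]: "f \<in> L2 \<Longrightarrow> (\<lambda>t. c * f t) \<in> L2"
  by (auto simp: L2_def norm_mult power_mult_distrib)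

lemma L2_add [simp, intro]:
  assumes "f \<in> L2" "g \<in> L2"
  shows "(\<lambda>t. f t + g t) \<in> L2"
proof -
  have "integrable lebesgue (\<lambda>t. (cmod (f t + g t))\<^sup>2)"
  proof (rule Bochner_Integration.integrable_bound)
    show "integrable lebesgue (\<lambda>t. 2 * (cmod (f t))\<^sup>2 + 2 * (cmod (g t))\<^sup>2)"
      using assms by (auto simp: L2_def)
    show "(\<lambda>t. (cmod (f t + g t))\<^sup>2) \<in> borel_measurable lebesgue"
      using assms L2_measurable by measurable
    show "AE t in lebesgue. norm ((cmod (f t + g t))\<^sup>2) \<le> norm (2 * (cmod (f t))\<^sup>2 + 2 * (cmod (g t))\<^sup>2)"
    proof (rule AE_I2)
      fix t
      have "(cmod (f t + g t))\<^sup>2 \<le> (cmod (f t) + cmod (g t))\<^sup>2"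
        by (intro power_mono norm_triangle_ineq) auto
      also have "\<dots> \<le> 2 * (cmod (f t))\<^sup>2 + 2 * (cmod (g t))\<^sup>2"
        using sum_squares_bound[of "cmod (f t)" "cmod (g t)"] by (simp add: power2_sum)
      finally show "norm ((cmod (f t + g t))\<^sup>2) \<le> norm (2 * (cmod (f t))\<^sup>2 + 2 * (cmod (g t))\<^sup>2)"
        by simp
    qed
  qed
  then show ?thesis using assms by (auto simp: L2_def)
qed

lemma L2_diff [simp, intro]:
  assumes "f \<in> L2" "g \<in> L2" shows "(\<lambda>t. f t - g t) \<in> L2"
  using L2_add[OF assms(1) L2_scale[OF assms(2), of "-1"]] by simp

lemma L2_AE_cong:
  assumes "f \<in> L2" "g \<in> borel_measurable lebesgue" "AE t in lebesgue. f t = g t"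
  shows "g \<in> L2"
proof -
  have "integrable lebesgue (\<lambda>t. (cmod (f t))\<^sup>2) \<longleftrightarrow> integrable lebesgue (\<lambda>t. (cmod (g t))\<^sup>2)"
    using assms by (intro integrable_cong_AE) (auto simp: L2_def)
  then show ?thesis using assms by (auto simp: L2_def)
qed

lemma l2_inner_add_left:
  "f \<in> L2 \<Longrightarrow> g \<in> L2 \<Longrightarrow> h \<in> L2 \<Longrightarrow> l2_inner (\<lambda>t. f t + g t) h = l2_inner f h + l2_inner g h"
  unfolding l2_inner_def by (simp add: distrib_right L2_integrable_mult)

lemma l2_inner_scale_left: "l2_inner (\<lambda>t. c * f t) h = c * l2_inner f h"
  unfolding l2_inner_def by (simp add: mult.assoc)

lemma l2_inner_diff_left:
  "f \<in> L2 \<Longrightarrow> g \<in> L2 \<Longrightarrow> h \<in> L2 \<Longrightarrow> l2_inner (\<lambda>t. f t - g t) h = l2_inner f h - l2_inner g h"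
  unfolding l2_inner_def by (simp add: left_diff_distrib L2_integrable_mult)

lemma l2_inner_commute: "l2_inner g f = cnj (l2_inner f g)"
  unfolding l2_inner_def by (subst Bochner_Integration.integral_cnj[symmetric]) (simp add: mult.commute)

lemma l2_inner_add_right:
  "f \<in> L2 \<Longrightarrow> g \<in> L2 \<Longrightarrow> h \<in> L2 \<Longrightarrow> l2_inner h (\<lambda>t. f t + g t) = l2_inner h f + l2_inner h g"
  by (subst (1 2 3) l2_inner_commute) (simp add: l2_inner_add_left)

lemma l2_inner_diff_right:
  "f \<in> L2 \<Longrightarrow> g \<in> L2 \<Longrightarrow> h \<in> L2 \<Longrightarrow> l2_inner h (\<lambda>t. f t - g t) = l2_inner h f - l2_inner h g"
  by (subst (1 2 3) l2_inner_commute) (simp add: l2_inner_diff_left)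

lemma l2_inner_scale_right: "l2_inner h (\<lambda>t. c * f t) = cnj c * l2_inner h f"
  by (subst (1 2) l2_inner_commute) (simp add: l2_inner_scale_left)

lemma l2_inner_self: "l2_inner f f = of_real ((l2_norm f)\<^sup>2)"
proof -
  have "(LINT t|lebesgue. (cmod (f t))\<^sup>2) \<ge> 0" by simp
  moreover have "f t * cnj (f t) = of_real ((cmod (f t))\<^sup>2)" for t
    by (rule complex_norm_square[symmetric])
  ultimately show ?thesis
    unfolding l2_inner_def l2_norm_def by (simp del: of_real_power)
qed

lemma l2_norm_nonneg [simp]: "0 \<le> l2_norm f"
  unfolding l2_norm_def by simp

lemma l2_norm_scale: "l2_norm (\<lambda>t. c * f t) = cmod c * l2_norm f"
  unfolding l2_norm_def by (simp add: norm_mult power_mult_distrib real_sqrt_mult)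

lemma l2_norm_add_sq:
  assumes "f \<in> L2" "g \<in> L2"
  shows "(l2_norm (\<lambda>t. f t + g t))\<^sup>2 = (l2_norm f)\<^sup>2 + 2 * Re (l2_inner f g) + (l2_norm g)\<^sup>2"
proof -
  let ?h = "\<lambda>t. f t + g t"
  have "complex_of_real ((l2_norm ?h)\<^sup>2)
      = l2_inner f f + (l2_inner f g + cnj (l2_inner f g)) + l2_inner g g"
    unfolding l2_inner_self[symmetric] using assms
    by (simp add: l2_inner_add_left l2_inner_add_right l2_inner_commute[of g f])
  also have "\<dots> = of_real ((l2_norm f)\<^sup>2 + 2 * Re (l2_inner f g) + (l2_norm g)\<^sup>2)"
    unfolding l2_inner_self complex_add_cnj by simp
  finally show ?thesis by (simp only: of_real_eq_iff)
qed

lemma l2_norm_minus: "l2_norm (\<lambda>t. - f t) = l2_norm f"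
  unfolding l2_norm_def by simp

lemma l2_norm_diff_sq:
  assumes "f \<in> L2" "g \<in> L2"
  shows "(l2_norm (\<lambda>t. f t - g t))\<^sup>2 = (l2_norm f)\<^sup>2 - 2 * Re (l2_inner f g) + (l2_norm g)\<^sup>2"
  using l2_norm_add_sq[OF assms(1) L2_scale[OF assms(2), of "-1"]] l2_inner_scale_right[of f "-1" g]
  by (simp add: l2_norm_minus)

lemma l2_Cauchy_Schwarz:
  assumes "f \<in> L2" "g \<in> L2"
  shows "cmod (l2_inner f g) \<le> l2_norm f * l2_norm g"
proof -
  have "(cmod (l2_inner f g))\<^sup>2 \<le> (l2_norm f)\<^sup>2 * (l2_norm g)\<^sup>2"
  proof (rule psd_form_discriminant)
    fix \<tau>
    have "0 \<le> (l2_norm (\<lambda>t. f t + \<tau> * g t))\<^sup>2" by simp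
    then show "0 \<le> (l2_norm f)\<^sup>2 + 2 * Re (cnj \<tau> * l2_inner f g) + (cmod \<tau>)\<^sup>2 * (l2_norm g)\<^sup>2"
      using assms by (simp add: l2_norm_add_sq l2_inner_scale_right l2_norm_scale power_mult_distrib)
  qed simp
  then show ?thesis
    by (simp add: power_mult_distrib[symmetric] power2_le_iff_abs_le)
qed

lemma l2_norm_triangle:
  assumes "f \<in> L2" "g \<in> L2"
  shows "l2_norm (\<lambda>t. f t + g t) \<le> l2_norm f + l2_norm g"
proof (rule power2_le_imp_le)
  have "Re (l2_inner f g) \<le> l2_norm f * l2_norm g"
    using l2_Cauchy_Schwarz[OF assms] complex_Re_le_cmod[of "l2_inner f g"] by linarith
  then show "(l2_norm (\<lambda>t. f t + g t))\<^sup>2 \<le> (l2_norm f + l2_norm g)\<^sup>2"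
    using assms by (simp add: l2_norm_add_sq power2_sum)
qed simp

lemma l2_norm_eq_0_iff:
  assumes "f \<in> L2" shows "l2_norm f = 0 \<longleftrightarrow> (AE t in lebesgue. f t = 0)"
proof -
  have "(LINT t|lebesgue. (cmod (f t))\<^sup>2) = 0 \<longleftrightarrow> (AE t in lebesgue. (cmod (f t))\<^sup>2 = 0)"
    using assms by (intro integral_nonneg_eq_0_iff_AE) (auto simp: L2_def)
  then show ?thesis unfolding l2_norm_def by simp
qed

lemma l2_inner_AE_cong_left:
  assumes "f \<in> borel_measurable lebesgue" "f' \<in> borel_measurable lebesgue" "AE t in lebesgue. f t = f' t"
    "g \<in> borel_measurable lebesgue"
  shows "l2_inner f g = l2_inner f' g"
proof -
  have "cnj \<in> borel_measurable borel"
    by (intro borel_measurable_continuous_onI continuous_intros)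
  then show ?thesis
    unfolding l2_inner_def using assms by (intro integral_cong_AE) (auto, measurable)
qed

text \<open>
  Fubini's theorem lives on the product of Borel \<open>\<sigma>\<close>-algebras; this lemma allows a Lebesgue
  measurable function to enter it.
\<close>

lemma borel_representative:
  fixes f :: "real \<Rightarrow> complex"
  assumes "f \<in> borel_measurable lebesgue"
  obtains g where "g \<in> borel_measurable borel" "AE t in lebesgue. f t = g t"
proof -
  have "(\<lambda>t. Re (f t)) \<in> borel_measurable lebesgue" "(\<lambda>t. Im (f t)) \<in> borel_measurable lebesgue"
    using assms by measurable
  then obtain a b where a: "a \<in> borel_measurable lborel" "AE t in lborel. Re (f t) = a t"
    and b: "b \<in> borel_measurable lborel" "AE t in lborel. Im (f t) = b t"
    using completion_ex_borel_measurable_real by metis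
  show thesis
  proof
    show "(\<lambda>t. Complex (a t) (b t)) \<in> borel_measurable borel"
      using a b by (simp add: Complex_eq)
    have "AE t in lborel. f t = Complex (a t) (b t)"
      using a(2) b(2) by eventually_elim (simp add: complex_eq_iff)
    then show "AE t in lebesgue. f t = Complex (a t) (b t)"
      by (rule AE_completion)
  qed
qed

section \<open>Gaussian atoms and the short-time Fourier transform\<close>

lemma gauss_at_eq:
  "gauss_at w t = of_real (2 powr (1/4) * exp (- pi * (t - Re w)\<^sup>2)) * exp (\<i> * of_real (2 * pi * Im w * t))"
  unfolding gauss_at_def gauss_def by (simp add: mult_ac)

lemma continuous_gauss_at: "continuous_on UNIV (gauss_at w)"
  unfolding gauss_at_eq[abs_def] by (intro continuous_intros)

lemma borel_measurable_gauss_at [measurable]: "gauss_at w \<in> borel_measurable borel"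
  by (rule borel_measurable_continuous_onI[OF continuous_gauss_at])

lemma root4_sq: "(2 powr (1/4))\<^sup>2 = sqrt (2::real)"
  by (simp add: power2_eq_square powr_add[symmetric] powr_half_sqrt)

lemma cmod_gauss_at: "cmod (gauss_at w t) = 2 powr (1/4) * exp (- pi * (t - Re w)\<^sup>2)"
  unfolding gauss_at_eq by (simp add: norm_mult)

lemma normal_density_narrow:
  "normal_density \<mu> (1 / (2 * sqrt pi)) t = sqrt 2 * exp (- 2 * pi * (t - \<mu>)\<^sup>2)"
proof -
  have r: "2 * pi * (1 / (2 * sqrt pi))\<^sup>2 = 1 / 2" "2 * (1 / (2 * sqrt pi))\<^sup>2 = 1 / (2 * pi)"
    by (simp_all add: power_divide power_mult_distrib)
  show ?thesis
    unfolding normal_density_def r by (simp add: real_sqrt_divide mult_ac)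
qed

text \<open>
  All integrals of Gaussian atoms are thereby moments or characteristic functions of normal
  distributions.
\<close>

lemma cmod_gauss_at_sq: "(cmod (gauss_at w t))\<^sup>2 = normal_density (Re w) (1 / (2 * sqrt pi)) t"
  unfolding normal_density_narrow cmod_gauss_at power_mult_distrib root4_sq
  by (simp add: exp_double[symmetric] mult_ac)

lemma gauss_at_L2 [simp, intro]: "gauss_at w \<in> L2"
proof -
  have "integrable lborel (\<lambda>t. (cmod (gauss_at w t))\<^sup>2)"
    unfolding cmod_gauss_at_sq by (rule integrable_normal_density) simp
  then have "integrable lebesgue (\<lambda>t. (cmod (gauss_at w t))\<^sup>2)"
    by (subst integrable_completion) auto
  moreover have "gauss_at w \<in> borel_measurable lebesgue"
    by (rule measurable_completion) simp
  ultimately show ?thesis by (simp add: L2_def)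
qed

lemma fourier_normal_density:
  assumes \<sigma>: "\<sigma> > 0"
  shows "(CLINT t|lborel. of_real (normal_density \<mu> \<sigma> t) * iexp (s * t))
      = iexp (s * \<mu>) * of_real (exp (- (s * \<sigma>)\<^sup>2 / 2))"
proof -
  have "of_real (exp (- (s * \<sigma>)\<^sup>2 / 2)) = (CLINT x|std_normal_distribution. iexp ((s * \<sigma>) * x))"
    using char_std_normal_distribution unfolding char_def by metis
  also have "\<dots> = (CLINT x|lborel. of_real (std_normal_density x) * iexp ((s * \<sigma>) * x))"
    by (subst integral_density) (auto simp: scaleR_conv_of_real)
  also have "\<dots> = \<bar>1 / \<sigma>\<bar> *\<^sub>R (CLINT t|lborel. of_real (std_normal_density (- \<mu> / \<sigma> + 1 / \<sigma> * t)) *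
      iexp ((s * \<sigma>) * (- \<mu> / \<sigma> + 1 / \<sigma> * t)))"
    by (rule lborel_integral_real_affine) (use \<sigma> in simp)
  also have "\<dots> = (CLINT t|lborel. iexp (- s * \<mu>) * (of_real (normal_density \<mu> \<sigma> t) * iexp (s * t)))"
    unfolding integral_scaleR_right[symmetric]
  proof (rule Bochner_Integration.integral_cong[OF refl])
    fix t
    have e: "(s * \<sigma>) * (- \<mu> / \<sigma> + 1 / \<sigma> * t) = - s * \<mu> + s * t"
      using \<sigma> by (simp add: field_simps)
    have "\<bar>1 / \<sigma>\<bar> * std_normal_density (- \<mu> / \<sigma> + 1 / \<sigma> * t) = normal_density \<mu> \<sigma> t"
    proof -
      have "(- \<mu> / \<sigma> + 1 / \<sigma> * t)\<^sup>2 / 2 = (t - \<mu>)\<^sup>2 / (2 * \<sigma>\<^sup>2)"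
        using \<sigma> by (simp add: field_simps power2_eq_square)
      then show ?thesis
        using \<sigma> unfolding normal_density_def by (simp add: real_sqrt_mult mult_ac)
    qed
    then have r: "\<bar>1 / \<sigma>\<bar> *\<^sub>R (complex_of_real (std_normal_density (- \<mu> / \<sigma> + 1 / \<sigma> * t)) * u)
        = of_real (normal_density \<mu> \<sigma> t) * u" for u
      unfolding scaleR_conv_of_real by (metis mult.assoc of_real_mult)
    show "\<bar>1 / \<sigma>\<bar> *\<^sub>R (of_real (std_normal_density (- \<mu> / \<sigma> + 1 / \<sigma> * t)) *
        iexp ((s * \<sigma>) * (- \<mu> / \<sigma> + 1 / \<sigma> * t)))
      = iexp (- s * \<mu>) * (of_real (normal_density \<mu> \<sigma> t) * iexp (s * t))"
      unfolding r unfolding e by (simp add: exp_add[symmetric] algebra_simps)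
  qed
  also have "\<dots> = iexp (- s * \<mu>) * (CLINT t|lborel. of_real (normal_density \<mu> \<sigma> t) * iexp (s * t))"
    by simp
  finally show ?thesis
    by (simp add: exp_minus field_simps)
qed

text \<open>
  The reproducing kernel of the Gaussian window. The product of two bumps is a bump at the midpoint
  \<open>m\<close> of their centres, times \<open>exp (- \<pi> (Re w - Re z)\<^sup>2 / 2)\<close>; the Fourier transform of that bump, taken at
  the difference \<open>\<eta>\<close> of the two frequencies, supplies the other factors. Every later computation with
  atoms goes through this formula.
\<close>

lemma gauss_inner:
  "l2_inner (gauss_at w) (gauss_at z)
    = of_real (exp (- pi * (cmod (w - z))\<^sup>2 / 2)) * exp (\<i> * of_real (pi * (Im w - Im z) * (Re w + Re z)))"
proof -
  define m where "m = (Re w + Re z) / 2"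
  define \<eta> where "\<eta> = Im w - Im z"
  define \<sigma> where "\<sigma> = 1 / (2 * sqrt pi)"
  have "l2_inner (gauss_at w) (gauss_at z) = (CLINT t|lborel. gauss_at w t * cnj (gauss_at z t))"
    unfolding l2_inner_def by (rule integral_completion) (simp, intro borel_measurable_continuous_onI continuous_intros continuous_gauss_at)
  also have "\<dots> = (CLINT t|lborel. of_real (exp (- pi * (Re w - Re z)\<^sup>2 / 2)) *
      (of_real (normal_density m \<sigma> t) * iexp ((2 * pi * \<eta>) * t)))"
  proof (rule Bochner_Integration.integral_cong[OF refl])
    fix t
    have "(2 powr (1/4) * exp (- pi * (t - Re w)\<^sup>2)) * (2 powr (1/4) * exp (- pi * (t - Re z)\<^sup>2))
      = sqrt 2 * exp (- pi * (t - Re w)\<^sup>2 + - pi * (t - Re z)\<^sup>2)"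
      unfolding root4_sq[symmetric] power2_eq_square[of "2 powr (1/4)"] exp_add by simp
    also have "- pi * (t - Re w)\<^sup>2 + - pi * (t - Re z)\<^sup>2 = - pi * (Re w - Re z)\<^sup>2 / 2 + - 2 * pi * (t - m)\<^sup>2"
      unfolding m_def by (simp add: power2_eq_square field_simps)
    finally have r: "(2 powr (1/4) * exp (- pi * (t - Re w)\<^sup>2)) * (2 powr (1/4) * exp (- pi * (t - Re z)\<^sup>2))
       = exp (- pi * (Re w - Re z)\<^sup>2 / 2) * normal_density m \<sigma> t"
      unfolding \<sigma>_def normal_density_narrow exp_add by (simp add: mult_ac)
    have "cnj (exp (\<i> * of_real (2 * pi * Im z * t))) = exp (\<i> * of_real (- 2 * pi * Im z * t))"
      by (simp add: exp_cnj)
    then have p: "exp (\<i> * of_real (2 * pi * Im w * t)) * cnj (exp (\<i> * of_real (2 * pi * Im z * t)))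
      = iexp ((2 * pi * \<eta>) * t)"
      by (simp add: exp_add[symmetric] \<eta>_def algebra_simps)
    have "gauss_at w t * cnj (gauss_at z t)
       = of_real ((2 powr (1/4) * exp (- pi * (t - Re w)\<^sup>2)) * (2 powr (1/4) * exp (- pi * (t - Re z)\<^sup>2)))
        * (exp (\<i> * of_real (2 * pi * Im w * t)) * cnj (exp (\<i> * of_real (2 * pi * Im z * t))))"
      unfolding gauss_at_eq complex_cnj_mult complex_cnj_complex_of_real of_real_mult[symmetric] by (simp add: mult_ac)
    then show "gauss_at w t * cnj (gauss_at z t) = of_real (exp (- pi * (Re w - Re z)\<^sup>2 / 2)) *
      (of_real (normal_density m \<sigma> t) * iexp ((2 * pi * \<eta>) * t))"
      unfolding r p by (simp add: mult.assoc)
  qed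
  also have "\<dots> = of_real (exp (- pi * (Re w - Re z)\<^sup>2 / 2)) *
     (iexp ((2 * pi * \<eta>) * m) * of_real (exp (- ((2 * pi * \<eta>) * \<sigma>)\<^sup>2 / 2)))"
    by (subst integral_mult_right_zero, subst fourier_normal_density) (auto simp: \<sigma>_def)
  also have "((2 * pi * \<eta>) * \<sigma>)\<^sup>2 = pi * \<eta>\<^sup>2"
    by (simp add: \<sigma>_def power_mult_distrib power_divide power2_eq_square)
  also have "of_real (exp (- pi * (Re w - Re z)\<^sup>2 / 2)) * (iexp ((2 * pi * \<eta>) * m) * of_real (exp (- (pi * \<eta>\<^sup>2) / 2)))
     = of_real (exp (- pi * (Re w - Re z)\<^sup>2 / 2 + - (pi * \<eta>\<^sup>2) / 2)) * iexp ((2 * pi * \<eta>) * m)"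
    unfolding exp_add by simp
  also have "- pi * (Re w - Re z)\<^sup>2 / 2 + - (pi * \<eta>\<^sup>2) / 2 = - pi * (cmod (w - z))\<^sup>2 / 2"
    by (simp add: cmod_power2 \<eta>_def field_simps)
  also have "(2 * pi * \<eta>) * m = pi * (Im w - Im z) * (Re w + Re z)"
    by (simp add: m_def \<eta>_def)
  finally show ?thesis .
qed

lemma l2_norm_gauss_at [simp]: "l2_norm (gauss_at w) = 1"
proof -
  have "complex_of_real ((l2_norm (gauss_at w))\<^sup>2) = 1"
    unfolding l2_inner_self[symmetric] by (simp add: gauss_inner)
  then have "(l2_norm (gauss_at w))\<^sup>2 = 1" by (simp only: of_real_eq_1_iff)
  then show ?thesis
    using l2_norm_nonneg[of "gauss_at w"] by (simp add: power2_eq_1_iff)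
qed

lemma stft_eq_inner: "stft f z = l2_inner f (gauss_at (Complex (fst z) (snd z)))"
  unfolding stft_def l2_inner_def gauss_at_def
  by (cases z) (simp add: exp_cnj mult_ac)

lemma stft_add: "f \<in> L2 \<Longrightarrow> g \<in> L2 \<Longrightarrow> stft (\<lambda>t. f t + g t) z = stft f z + stft g z"
  by (simp add: stft_eq_inner l2_inner_add_left)

lemma stft_diff: "f \<in> L2 \<Longrightarrow> g \<in> L2 \<Longrightarrow> stft (\<lambda>t. f t - g t) z = stft f z - stft g z"
  by (simp add: stft_eq_inner l2_inner_diff_left)

lemma stft_scale: "stft (\<lambda>t. c * f t) z = c * stft f z"
  by (simp add: stft_eq_inner l2_inner_scale_left)

lemma stft_bound: "f \<in> L2 \<Longrightarrow> cmod (stft f z) \<le> l2_norm f"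
  unfolding stft_eq_inner using l2_Cauchy_Schwarz[of f "gauss_at (Complex (fst z) (snd z))"] by simp

text \<open>
  A modulus of continuity shared by the transforms \<open>stft f\<close> of all \<open>f\<close> in the unit ball.
\<close>

definition shift_dist :: "real \<times> real \<Rightarrow> real \<times> real \<Rightarrow> real" where
  "shift_dist z w = l2_norm (\<lambda>t. gauss_at (Complex (fst z) (snd z)) t - gauss_at (Complex (fst w) (snd w)) t)"

lemma stft_modulus_of_continuity:
  assumes "f \<in> L2" shows "cmod (stft f z - stft f w) \<le> l2_norm f * shift_dist z w"
  using assms unfolding stft_eq_inner shift_dist_def
  by (subst l2_inner_diff_right[symmetric]) (auto intro!: l2_Cauchy_Schwarz)

lemma shift_dist_tendsto: "((\<lambda>w. shift_dist z w) \<longlongrightarrow> 0) (at z within S)"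
proof -
  define g where "g w = sqrt (2 - 2 * Re (of_real (exp (- pi * (cmod (Complex (fst z) (snd z) - Complex (fst w) (snd w)))\<^sup>2 / 2))
     * exp (\<i> * of_real (pi * (snd z - snd w) * (fst z + fst w)))))" for w
  have "continuous_on UNIV g"
    unfolding g_def Complex_eq by (intro continuous_intros) auto
  then have "(g \<longlongrightarrow> g z) (at z within S)"
    by (meson continuous_on_def at_within_eq UNIV_I subset_UNIV tendsto_within_subset)
  moreover have "g = shift_dist z"
  proof
    fix w show "g w = shift_dist z w"
    using l2_norm_diff_sq[of "gauss_at (Complex (fst z) (snd z))" "gauss_at (Complex (fst w) (snd w))"]
    unfolding g_def shift_dist_def by (simp add: gauss_inner real_sqrt_unique)
  qed
  moreover have "g z = 0" unfolding g_def by simp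
  ultimately show ?thesis by simp
qed

lemma continuous_stft: assumes "f \<in> L2" shows "continuous_on UNIV (stft f)"
  unfolding continuous_on_def
proof
  fix z
  have "((\<lambda>w. cmod (stft f w - stft f z)) \<longlongrightarrow> 0) (at z within UNIV)"
  proof (rule tendsto_sandwich[OF _ _ tendsto_const])
    show "\<forall>\<^sub>F w in at z. cmod (stft f w - stft f z) \<le> l2_norm f * shift_dist z w"
      by (intro always_eventually allI, subst norm_minus_commute)
        (rule stft_modulus_of_continuity[OF assms])
    show "((\<lambda>w. l2_norm f * shift_dist z w) \<longlongrightarrow> 0) (at z)"
      using tendsto_mult[OF tendsto_const shift_dist_tendsto, of "l2_norm f" z UNIV] by simp
  qed simp
  then show "(stft f \<longlongrightarrow> stft f z) (at z)"
    by (simp add: tendsto_norm_zero_iff LIM_zero_iff)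
qed

lemma borel_measurable_stft: "f \<in> L2 \<Longrightarrow> stft f \<in> borel_measurable borel"
  by (intro borel_measurable_continuous_onI continuous_stft)

section \<open>The form of a localization operator and its adjoint map\<close>

definition stft_form :: "(real \<times> real) set \<Rightarrow> (real \<Rightarrow> complex) \<Rightarrow> (real \<Rightarrow> complex) \<Rightarrow> complex" where
  "stft_form U f g = (LINT z:U|lborel. stft f z * cnj (stft g z))"

text \<open>
  The adjoint of the short-time Fourier transform, cut off to \<open>U\<close>; thus \<open>\<L>\<^sub>U f\<close> is represented by
  \<open>synthesis U (stft f)\<close>. Since it is given by a pointwise formula, limits of the form \<open>\<L>\<^sub>U f\<^sub>n\<close> can be
  written down without knowing that \<open>L\<^sup>2\<close> is complete.
\<close>

definition synthesis :: "(real \<times> real) set \<Rightarrow> (real \<times> real \<Rightarrow> complex) \<Rightarrow> real \<Rightarrow> complex" where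
  "synthesis U G t = (LINT z:U|lborel. G z * gauss_at (Complex (fst z) (snd z)) t)"

lemma borel_measurable_cnj [measurable]: "cnj \<in> borel_measurable borel"
  by (intro borel_measurable_continuous_onI continuous_intros)

lemma set_integral_lebesgue_lborel:
  fixes f :: "'a::euclidean_space \<Rightarrow> complex"
  assumes [measurable]: "U \<in> sets borel" "f \<in> borel_measurable borel"
  shows "(LINT z:U|lebesgue. f z) = (LINT z:U|lborel. f z)"
  unfolding set_lebesgue_integral_def by (rule integral_completion) measurable

locale plane_domain =
  fixes U :: "(real \<times> real) set"
  assumes borel_U [measurable]: "U \<in> sets borel"
    and finite_U: "emeasure lborel U < \<infinity>"
begin

lemma set_integrable_bounded:
  fixes F :: "real \<times> real \<Rightarrow> 'b::{banach, second_countable_topology}"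
  assumes "F \<in> borel_measurable borel" "\<And>z. z \<in> U \<Longrightarrow> norm (F z) \<le> K"
  shows "set_integrable lborel U F"
  unfolding set_integrable_def
  by (rule integrableI_bounded_set_indicator[where B=K]) (use assms finite_U in auto)

lemma set_integral_norm_bound':
  fixes F :: "real \<times> real \<Rightarrow> 'b::{banach, second_countable_topology}"
  assumes "F \<in> borel_measurable borel" "\<And>z. z \<in> U \<Longrightarrow> norm (F z) \<le> K"
  shows "norm (LINT z:U|lborel. F z) \<le> K * measure lborel U"
proof -
  have "norm (LINT z:U|lborel. F z) \<le> (LINT z:U|lborel. norm (F z))"
    using set_integrable_bounded[OF assms] by (rule set_integral_norm_bound)
  also have "\<dots> \<le> (LINT z:U|lborel. K)"
  proof (intro set_integral_mono set_integrable_bounded[where K=K])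
    show "norm K \<le> K" if "z \<in> U" for z
      using order_trans[OF norm_ge_zero assms(2)[OF that]] by simp
  qed (use assms in auto)
  also have "\<dots> = K * measure lborel U"
    using finite_U by (simp add: set_integral_const)
  finally show ?thesis .
qed

lemma stft_form_integrable:
  assumes "f \<in> L2" "g \<in> L2"
  shows "set_integrable lborel U (\<lambda>z. stft f z * cnj (stft g z))"
proof (rule set_integrable_bounded)
  note [measurable] = borel_measurable_stft[OF assms(1)] borel_measurable_stft[OF assms(2)]
  show "(\<lambda>z. stft f z * cnj (stft g z)) \<in> borel_measurable borel" by measurable
  show "norm (stft f z * cnj (stft g z)) \<le> l2_norm f * l2_norm g" for z
    unfolding norm_mult complex_mod_cnj using stft_bound assms by (intro mult_mono) auto
qed

lemma stft_form_add_left: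
  "f \<in> L2 \<Longrightarrow> g \<in> L2 \<Longrightarrow> h \<in> L2 \<Longrightarrow> stft_form U (\<lambda>t. f t + g t) h = stft_form U f h + stft_form U g h"
  unfolding stft_form_def by (simp add: stft_add distrib_right stft_form_integrable)

lemma stft_form_diff_left:
  "f \<in> L2 \<Longrightarrow> g \<in> L2 \<Longrightarrow> h \<in> L2 \<Longrightarrow> stft_form U (\<lambda>t. f t - g t) h = stft_form U f h - stft_form U g h"
  unfolding stft_form_def by (simp add: stft_diff left_diff_distrib stft_form_integrable)

lemma stft_form_scale_left: "stft_form U (\<lambda>t. c * f t) h = c * stft_form U f h"
  unfolding stft_form_def by (simp add: stft_scale mult.assoc)

lemma stft_form_commute: "stft_form U g f = cnj (stft_form U f g)"
  unfolding stft_form_def set_lebesgue_integral_def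
  by (subst Bochner_Integration.integral_cnj[symmetric]) (simp add: mult.commute)

lemma stft_form_add_right:
  "f \<in> L2 \<Longrightarrow> g \<in> L2 \<Longrightarrow> h \<in> L2 \<Longrightarrow> stft_form U h (\<lambda>t. f t + g t) = stft_form U h f + stft_form U h g"
  by (subst (1 2 3) stft_form_commute) (simp add: stft_form_add_left)

lemma stft_form_scale_right: "stft_form U h (\<lambda>t. c * f t) = cnj c * stft_form U h f"
  by (subst (1 2) stft_form_commute) (simp add: stft_form_scale_left)

lemma stft_form_bound:
  assumes "f \<in> L2" "g \<in> L2"
  shows "cmod (stft_form U f g) \<le> measure lborel U * (l2_norm f * l2_norm g)"
proof -
  note [measurable] = borel_measurable_stft[OF assms(1)] borel_measurable_stft[OF assms(2)]
  have "norm (LINT z:U|lborel. stft f z * cnj (stft g z)) \<le> (l2_norm f * l2_norm g) * measure lborel U"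
  proof (rule set_integral_norm_bound')
    show "norm (stft f z * cnj (stft g z)) \<le> l2_norm f * l2_norm g" for z
      unfolding norm_mult complex_mod_cnj using stft_bound assms by (intro mult_mono) auto
  qed measurable
  then show ?thesis by (simp add: stft_form_def mult.commute)
qed

definition stft_energy :: "(real \<Rightarrow> complex) \<Rightarrow> real" where
  "stft_energy f = (LINT z:U|lborel. (cmod (stft f z))\<^sup>2)"

lemma stft_form_self: "stft_form U f f = of_real (stft_energy f)"
  unfolding stft_form_def stft_energy_def set_lebesgue_integral_def
  by (subst integral_complex_of_real[symmetric])
    (simp add: complex_norm_square[symmetric] scaleR_conv_of_real flip: of_real_power)

lemma stft_energy_add:
  assumes "f \<in> L2" "g \<in> L2"
  shows "stft_energy (\<lambda>t. f t + g t) = stft_energy f + 2 * Re (stft_form U f g) + stft_energy g"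
proof -
  let ?h = "\<lambda>t. f t + g t"
  have "complex_of_real (stft_energy ?h)
      = stft_form U f f + (stft_form U f g + cnj (stft_form U f g)) + stft_form U g g"
    unfolding stft_form_self[symmetric] using assms
    by (simp add: stft_form_add_left stft_form_add_right stft_form_commute[of g f])
  also have "\<dots> = of_real (stft_energy f + 2 * Re (stft_form U f g) + stft_energy g)"
    unfolding stft_form_self complex_add_cnj by simp
  finally show ?thesis by (simp only: of_real_eq_iff)
qed

lemma stft_energy_scale: "stft_energy (\<lambda>t. c * f t) = (cmod c)\<^sup>2 * stft_energy f"
  unfolding stft_energy_def by (simp add: stft_scale norm_mult power_mult_distrib)

lemma stft_energy_bound:
  assumes "f \<in> L2" shows "stft_energy f \<le> measure lborel U * (l2_norm f)\<^sup>2"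
  using stft_form_bound[OF assms assms] complex_Re_le_cmod[of "stft_form U f f"]
  by (simp add: stft_form_self power2_eq_square)

lemma stft_energy_nonneg: "0 \<le> stft_energy f"
  unfolding stft_energy_def set_lebesgue_integral_def by simp

lemma continuous_gauss_at_joint:
  "continuous_on UNIV (\<lambda>p::(real \<times> real) \<times> real. gauss_at (Complex (fst (fst p)) (snd (fst p))) (snd p))"
  unfolding gauss_at_eq by (simp, intro continuous_intros)

lemma measurable_gauss_at_joint [measurable]:
  "(\<lambda>p::(real \<times> real) \<times> real. gauss_at (Complex (fst (fst p)) (snd (fst p))) (snd p))
    \<in> borel_measurable (lborel \<Otimes>\<^sub>M lborel)"
  using borel_measurable_continuous_onI[OF continuous_gauss_at_joint]
  by (simp add: lborel_prod)

text \<open>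
  A joint Fubini argument for two pairings: \<open>k = 1\<close> shows that a synthesized function is integrable,
  and \<open>k = cnj g\<close> computes its inner product with \<open>g\<close>.
\<close>

lemma synthesis_integrable:
  assumes [measurable]: "G \<in> borel_measurable borel" "k \<in> borel_measurable borel"
    and G: "\<And>z. cmod (G z) \<le> K"
    and k: "\<And>w. integrable lborel (\<lambda>t. gauss_at w t * k t)"
      "\<And>w. (LINT t|lborel. cmod (gauss_at w t * k t)) \<le> N"
  shows "integrable (lborel \<Otimes>\<^sub>M lborel)
    (\<lambda>(z, t). indicator U z *\<^sub>R (G z * gauss_at (Complex (fst z) (snd z)) t * k t))" (is "integrable _ ?F")
proof (rule lborel_pair.Fubini_integrable)
  have [measurable]: "(\<lambda>p. G (fst p)) \<in> borel_measurable (lborel \<Otimes>\<^sub>M lborel)"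
    "(\<lambda>p. k (snd p)) \<in> borel_measurable (lborel \<Otimes>\<^sub>M lborel)"
    "(\<lambda>p. indicator U (fst p) :: real) \<in> borel_measurable (lborel \<Otimes>\<^sub>M lborel)"
    by measurable
  show F [measurable]: "?F \<in> borel_measurable (lborel \<Otimes>\<^sub>M lborel)"
    unfolding case_prod_beta by measurable
  show "AE z in lborel. integrable lborel (\<lambda>t. ?F (z, t))"
    using k(1) by (simp add: mult.assoc)
  have eq: "(LINT t|lborel. norm (?F (z, t)))
      = indicator U z *\<^sub>R (cmod (G z) * (LINT t|lborel. cmod (gauss_at (Complex (fst z) (snd z)) t * k t)))" for z
    by (simp add: mult.assoc norm_mult)
  have "(\<lambda>z. LINT t|lborel. norm (?F (z, t))) \<in> borel_measurable lborel"
    by (rule lborel.borel_measurable_lebesgue_integral) (use F in measurable)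
  then have m: "(\<lambda>z. LINT t|lborel. norm (?F (z, t))) \<in> borel_measurable borel" by simp
  have N: "N \<ge> 0" using k(2)[of 0] by (rule order_trans[rotated]) simp
  have "set_integrable lborel U (\<lambda>z. LINT t|lborel. norm (?F (z, t)))"
  proof (rule set_integrable_bounded[OF m])
    fix z assume "z \<in> U"
    then show "norm (LINT t|lborel. norm (?F (z, t))) \<le> K * N"
      unfolding eq using G[of z] k(2) N by (auto intro!: mult_mono order_trans[OF norm_ge_zero G])
  qed
  moreover have "indicator U z *\<^sub>R (LINT t|lborel. norm (?F (z, t))) = (LINT t|lborel. norm (?F (z, t)))" for z
    unfolding eq by (simp split: split_indicator)
  ultimately show "integrable lborel (\<lambda>z. LINT t|lborel. norm (?F (z, t)))"
    unfolding set_integrable_def by (simp only:)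
qed

lemma synthesis_Fubini:
  assumes "G \<in> borel_measurable borel" "k \<in> borel_measurable borel"
    and "\<And>z. cmod (G z) \<le> K"
    and "\<And>w. integrable lborel (\<lambda>t. gauss_at w t * k t)"
      "\<And>w. (LINT t|lborel. cmod (gauss_at w t * k t)) \<le> N"
  shows "integrable lborel (\<lambda>t. synthesis U G t * k t)"
    and "(LINT t|lborel. synthesis U G t * k t)
      = (LINT z:U|lborel. G z * (LINT t|lborel. gauss_at (Complex (fst z) (snd z)) t * k t))"
proof -
  note I = synthesis_integrable[OF assms]
  have eq: "(LINT z|lborel. indicator U z *\<^sub>R (G z * gauss_at (Complex (fst z) (snd z)) t * k t))
     = synthesis U G t * k t" for t
    unfolding synthesis_def set_lebesgue_integral_def
    by (subst integral_mult_left_zero[symmetric]) (simp add: mult.assoc)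
  show "integrable lborel (\<lambda>t. synthesis U G t * k t)"
    using lborel_pair.integrable_snd[OF I] by (simp only: eq)
  show "(LINT t|lborel. synthesis U G t * k t)
      = (LINT z:U|lborel. G z * (LINT t|lborel. gauss_at (Complex (fst z) (snd z)) t * k t))"
    using lborel_pair.Fubini_integral[OF I] unfolding eq set_lebesgue_integral_def
    by (simp add: mult.assoc)
qed

lemma gauss_at_L1:
  "integrable lborel (gauss_at w)" "(LINT t|lborel. cmod (gauss_at w t)) = 2 powr (1/4)"
proof -
  have *: "cmod (gauss_at w t) = 2 powr (1/4) * normal_density (Re w) (1 / sqrt (2 * pi)) t" for t
    unfolding cmod_gauss_at normal_density_def by (simp add: power_divide mult.commute)
  show "integrable lborel (gauss_at w)"
  proof (subst integrable_norm_iff[symmetric])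
    show "integrable lborel (\<lambda>t. norm (gauss_at w t))"
      unfolding * by (intro integrable_mult_right integrable_normal_density) simp
  qed simp
  show "(LINT t|lborel. cmod (gauss_at w t)) = 2 powr (1/4)"
    unfolding * by (simp add: integral_normal_density)
qed

lemma synthesis_measurable:
  assumes "G \<in> borel_measurable borel" "\<And>z. cmod (G z) \<le> K"
  shows "synthesis U G \<in> borel_measurable borel"
  using synthesis_Fubini(1)[of G "\<lambda>_. 1" K "2 powr (1/4)"] gauss_at_L1 assms
  by (auto dest: borel_measurable_integrable)

text \<open>
  A synthesized function is bounded and integrable, hence square integrable.
\<close>

lemma synthesis_L2:
  assumes G: "G \<in> borel_measurable borel" "\<And>z. cmod (G z) \<le> K"
  shows "synthesis U G \<in> L2"
proof -
  note [measurable] = G(1) synthesis_measurable[OF G]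
  have int: "integrable lborel (synthesis U G)"
    using synthesis_Fubini(1)[of G "\<lambda>_. 1" K "2 powr (1/4)"] gauss_at_L1 G by simp
  have K: "0 \<le> K" using G(2)[of 0] norm_ge_zero[of "G 0"] by linarith
  let ?B = "K * 2 powr (1/4) * measure lborel U"
  have bd: "cmod (synthesis U G t) \<le> ?B" for t
    unfolding synthesis_def
  proof (rule set_integral_norm_bound')
    have "(\<lambda>z::real\<times>real. gauss_at (Complex (fst z) (snd z)) t) \<in> borel_measurable borel"
      using continuous_gauss_at_joint
      by (intro borel_measurable_continuous_onI continuous_on_compose2[OF continuous_gauss_at_joint, of UNIV "\<lambda>z. (z, t)", simplified] continuous_intros)
    then show "(\<lambda>z. G z * gauss_at (Complex (fst z) (snd z)) t) \<in> borel_measurable borel"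
      by measurable
    show "cmod (G z * gauss_at (Complex (fst z) (snd z)) t) \<le> K * 2 powr (1/4)" for z
      unfolding norm_mult using G(2)[of z] K by (intro mult_mono) (auto simp: cmod_gauss_at)
  qed
  have "integrable lborel (\<lambda>t. (cmod (synthesis U G t))\<^sup>2)"
  proof (rule Bochner_Integration.integrable_bound)
    show "integrable lborel (\<lambda>t. ?B * cmod (synthesis U G t))"
      using int by (intro integrable_mult_right integrable_norm)
    show "AE t in lborel. norm ((cmod (synthesis U G t))\<^sup>2) \<le> norm (?B * cmod (synthesis U G t))"
      using bd K by (intro AE_I2) (auto simp: power2_eq_square norm_mult intro!: mult_right_mono)
  qed measurable
  then have "integrable lebesgue (\<lambda>t. (cmod (synthesis U G t))\<^sup>2)"
    by (subst integrable_completion) auto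
  moreover have "synthesis U G \<in> borel_measurable lebesgue"
    by (rule measurable_completion) simp
  ultimately show ?thesis by (simp add: L2_def)
qed

lemma synthesis_inner:
  assumes G: "G \<in> borel_measurable borel" "\<And>z. cmod (G z) \<le> K" and g: "g \<in> L2"
  shows "l2_inner (synthesis U G) g = (LINT z:U|lborel. G z * cnj (stft g z))"
proof -
  obtain g' where g' [measurable]: "g' \<in> borel_measurable borel" and ae: "AE t in lebesgue. g t = g' t"
    using borel_representative[OF L2_measurable[OF g]] by blast
  have g'L: "g' \<in> borel_measurable lebesgue" by (rule measurable_completion) simp
  have g'2: "g' \<in> L2" by (rule L2_AE_cong[OF g g'L ae])
  have same: "l2_inner f g = l2_inner f g'" if "f \<in> L2" for f
    using l2_inner_AE_cong_left[OF L2_measurable[OF g] g'L ae L2_measurable[OF that]]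
    by (subst (1 2) l2_inner_commute) simp
  have lb: "(LINT t|lborel. f t * cnj (g' t)) = l2_inner f g'" "integrable lborel (\<lambda>t. f t * cnj (g' t))"
    if f: "f \<in> L2" and [measurable]: "f \<in> borel_measurable borel" for f
  proof -
    show "(LINT t|lborel. f t * cnj (g' t)) = l2_inner f g'"
      unfolding l2_inner_def by (rule integral_completion[symmetric]) measurable
    show "integrable lborel (\<lambda>t. f t * cnj (g' t))"
      using L2_integrable_mult[OF f g'2] by (subst (asm) integrable_completion) auto
  qed
  have bd: "(LINT t|lborel. cmod (gauss_at w t * cnj (g' t))) \<le> l2_norm g'" for w
  proof -
    let ?a = "\<lambda>t. complex_of_real (cmod (gauss_at w t))" and ?b = "\<lambda>t. complex_of_real (cmod (g' t))"
    have L: "?a \<in> L2" "?b \<in> L2"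
      using g'2 gauss_at_L2[of w] by (auto simp: L2_def)
    have "l2_inner ?a ?b = (LINT t|lborel. of_real (cmod (gauss_at w t * cnj (g' t))))"
      unfolding l2_inner_def by (subst integral_completion) (auto simp: norm_mult)
    also have "\<dots> = of_real (LINT t|lborel. cmod (gauss_at w t * cnj (g' t)))" by simp
    finally have "\<bar>LINT t|lborel. cmod (gauss_at w t * cnj (g' t))\<bar> = cmod (l2_inner ?a ?b)" by simp
    also have "\<dots> \<le> l2_norm ?a * l2_norm ?b" by (rule l2_Cauchy_Schwarz[OF L])
    also have "l2_norm ?a = l2_norm (gauss_at w)"
      unfolding l2_norm_def by simp
    also have "l2_norm ?b = l2_norm g'"
      unfolding l2_norm_def by simp
    finally show ?thesis by simp
  qed
  have "l2_inner (synthesis U G) g = l2_inner (synthesis U G) g'"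
    by (rule same[OF synthesis_L2[OF G]])
  also have "\<dots> = (LINT t|lborel. synthesis U G t * cnj (g' t))"
    by (rule lb(1)[symmetric]) (use synthesis_L2[OF G] synthesis_measurable[OF G] in auto)
  also have "\<dots> = (LINT z:U|lborel. G z * (LINT t|lborel. gauss_at (Complex (fst z) (snd z)) t * cnj (g' t)))"
    by (rule synthesis_Fubini(2)[where K=K and N="l2_norm g'"]) (use G bd lb(2) in auto)
  also have "\<dots> = (LINT z:U|lborel. G z * cnj (stft g z))"
    by (simp add: lb(1) same[symmetric] stft_eq_inner flip: l2_inner_commute)
  finally show ?thesis .
qed

end

section \<open>The largest eigenvalue as a maximum\<close>

text \<open>
  A substitute for the weak sequential compactness of the unit ball: transforms of unit vectors are
  bounded by \<open>1\<close> and equicontinuous, so a diagonal subsequence that converges on a countable dense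
  set of phase space converges everywhere.
\<close>

lemma stft_pointwise_convergent_subsequence:
  fixes f :: "nat \<Rightarrow> real \<Rightarrow> complex"
  assumes L2: "\<And>n. f n \<in> L2" and norm: "\<And>n. l2_norm (f n) \<le> 1"
  obtains k G where "strict_mono (k :: nat \<Rightarrow> nat)" "\<And>z. (\<lambda>n. stft (f (k n)) z) \<longlonglongrightarrow> G z"
proof -
  obtain D :: "(real \<times> real) set" where "countable D"
    and dense: "\<And>X. open X \<Longrightarrow> X \<noteq> {} \<Longrightarrow> \<exists>d\<in>D. d \<in> X"
    by (rule countable_dense_setE) blast
  have le1: "cmod (stft (f n) z) \<le> 1" for n z
    using stft_bound[OF L2, of n z] norm[of n] by linarith
  obtain k :: "nat \<Rightarrow> nat" where k: "strict_mono k"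
    and conv: "\<And>d. d \<in> D \<Longrightarrow> \<exists>l. (\<lambda>n. stft (f (k n)) d) \<longlonglongrightarrow> l"
    using function_convergent_subsequence[OF \<open>countable D\<close>, of "\<lambda>n. stft (f n)" 1] le1 by blast
  have "convergent (\<lambda>n. stft (f (k n)) z)" for z
  proof (rule Cauchy_convergent, rule metric_CauchyI)
    fix e :: real assume "e > 0"
    then have "\<forall>\<^sub>F w in at z. shift_dist z w < e / 3"
      using order_tendstoD(2)[OF shift_dist_tendsto, of "e / 3" z UNIV] by simp
    then obtain \<delta> where "\<delta> > 0" and \<delta>: "\<And>w. w \<noteq> z \<Longrightarrow> dist w z < \<delta> \<Longrightarrow> shift_dist z w < e / 3"
      unfolding eventually_at by auto
    obtain d where "d \<in> D" "d \<in> ball z \<delta>" using dense[of "ball z \<delta>"] \<open>\<delta> > 0\<close> by auto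
    have "shift_dist z z = 0" by (simp add: shift_dist_def l2_norm_def)
    then have sd: "shift_dist z d < e / 3"
      using \<delta>[of d] \<open>d \<in> ball z \<delta>\<close> \<open>e > 0\<close> by (cases "d = z") (auto simp: dist_commute)
    have near: "cmod (stft (f n) z - stft (f n) d) < e / 3" for n
    proof -
      have "cmod (stft (f n) z - stft (f n) d) \<le> l2_norm (f n) * shift_dist z d"
        by (rule stft_modulus_of_continuity[OF L2])
      also have "\<dots> \<le> 1 * shift_dist z d"
        using norm by (intro mult_right_mono) (auto simp: shift_dist_def)
      finally show ?thesis using sd by simp
    qed
    have "Cauchy (\<lambda>n. stft (f (k n)) d)"
      using conv[OF \<open>d \<in> D\<close>] LIMSEQ_imp_Cauchy by blast
    then obtain N where N: "\<And>m n. m \<ge> N \<Longrightarrow> n \<ge> N \<Longrightarrow> dist (stft (f (k m)) d) (stft (f (k n)) d) < e / 3"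
      using \<open>e > 0\<close> metric_CauchyD[of "\<lambda>n. stft (f (k n)) d" "e / 3"] by auto
    show "\<exists>N. \<forall>m\<ge>N. \<forall>n\<ge>N. dist (stft (f (k m)) z) (stft (f (k n)) z) < e"
    proof (intro exI allI impI)
      fix m n assume "N \<le> m" "N \<le> n"
      have "dist (stft (f (k m)) z) (stft (f (k n)) z)
        \<le> dist (stft (f (k m)) z) (stft (f (k m)) d) + dist (stft (f (k m)) d) (stft (f (k n)) d)
          + dist (stft (f (k n)) d) (stft (f (k n)) z)"
        by metric
      also have "\<dots> < e / 3 + e / 3 + e / 3"
        using N[OF \<open>N \<le> m\<close> \<open>N \<le> n\<close>] near[of "k m"] near[of "k n"]
        by (simp add: dist_norm norm_minus_commute[of "stft (f (k n)) d"])
      finally show "dist (stft (f (k m)) z) (stft (f (k n)) z) < e" by simp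
    qed
  qed
  then have "\<forall>z. \<exists>l. (\<lambda>n. stft (f (k n)) z) \<longlonglongrightarrow> l" by (simp add: convergent_def)
  then obtain G where "\<And>z. (\<lambda>n. stft (f (k n)) z) \<longlonglongrightarrow> G z" by metis
  with k that show thesis by blast
qed

lemma stft_gauss_at:
  "stft (gauss_at w) z = of_real (exp (- pi * (cmod (w - Complex (fst z) (snd z)))\<^sup>2 / 2))
     * exp (\<i> * of_real (pi * (Im w - snd z) * (Re w + fst z)))"
  by (simp add: stft_eq_inner gauss_inner)

lemma cmod_stft_gauss_at_sq:
  "(cmod (stft (gauss_at w) z))\<^sup>2 = exp (- pi * (cmod (w - Complex (fst z) (snd z)))\<^sup>2)"
  by (simp add: stft_gauss_at norm_mult exp_double[symmetric])

context plane_domain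
begin

lemma stft_energy_gauss_at:
  "stft_energy (gauss_at w) = (LINT z:U|lborel. exp (- pi * (cmod (w - Complex (fst z) (snd z)))\<^sup>2))"
  unfolding stft_energy_def cmod_stft_gauss_at_sq ..

lemma stft_energy_gauss_at_pos:
  assumes pos: "0 < measure lborel U"
  shows "0 < stft_energy (gauss_at w)"
proof -
  let ?F = "\<lambda>z. exp (- pi * (cmod (w - Complex (fst z) (snd z)))\<^sup>2)"
  have "?F \<in> borel_measurable borel"
    unfolding Complex_eq by (intro borel_measurable_continuous_onI continuous_intros)
  then have int: "integrable lborel (\<lambda>z. indicator U z *\<^sub>R ?F z)"
    using set_integrable_bounded[of ?F 1] by (simp add: set_integrable_def)
  have "stft_energy (gauss_at w) \<noteq> 0"
  proof
    assume "stft_energy (gauss_at w) = 0"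
    then have "AE z in lborel. indicator U z *\<^sub>R ?F z = 0"
      unfolding stft_energy_gauss_at set_lebesgue_integral_def
      by (subst (asm) integral_nonneg_eq_0_iff_AE[OF int]) auto
    then have "AE z in lborel. z \<notin> U"
      by eventually_elim (auto simp: indicator_def split: if_splits)
    then have "emeasure lborel U = 0" using AE_iff_null_sets[of U lborel] by auto
    then show False using pos by (simp add: measure_def)
  qed
  then show ?thesis using stft_energy_nonneg[of "gauss_at w"] by simp
qed

lemma stft_form_tendsto:
  assumes L2: "\<And>n. f n \<in> L2" "g \<in> L2" and bd: "\<And>n. l2_norm (f n) \<le> 1"
    and G: "\<And>z. (\<lambda>n. stft (f n) z) \<longlonglongrightarrow> G z"
  shows "(\<lambda>n. stft_form U (f n) g) \<longlonglongrightarrow> (LINT z:U|lborel. G z * cnj (stft g z))"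
  unfolding stft_form_def set_lebesgue_integral_def
proof (rule integral_dominated_convergence[where w="\<lambda>z. indicator U z *\<^sub>R l2_norm g"])
  note [measurable] = borel_measurable_stft[OF L2(1)] borel_measurable_stft[OF L2(2)]
  have [measurable]: "G \<in> borel_measurable borel"
    by (rule borel_measurable_LIMSEQ_metric[OF _ G]) measurable
  show "(\<lambda>z. indicator U z *\<^sub>R (G z * cnj (stft g z))) \<in> borel_measurable lborel" by measurable
  show "(\<lambda>z. indicator U z *\<^sub>R (stft (f n) z * cnj (stft g z))) \<in> borel_measurable lborel" for n
    by measurable
  show "integrable lborel (\<lambda>z. indicator U z *\<^sub>R l2_norm g)"
    using set_integrable_bounded[of "\<lambda>_. l2_norm g" "l2_norm g"] by (simp add: set_integrable_def)
  show "AE z in lborel. (\<lambda>n. indicator U z *\<^sub>R (stft (f n) z * cnj (stft g z)))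
      \<longlonglongrightarrow> indicator U z *\<^sub>R (G z * cnj (stft g z))"
    by (intro AE_I2 tendsto_intros G)
  have "cmod (stft (f n) z * cnj (stft g z)) \<le> 1 * l2_norm g" for n z
    unfolding norm_mult complex_mod_cnj using stft_bound[OF L2(1), of n z] stft_bound[OF L2(2)] bd[of n]
    by (intro mult_mono) auto
  then show "AE z in lborel. norm (indicator U z *\<^sub>R (stft (f n) z * cnj (stft g z))) \<le> indicator U z *\<^sub>R l2_norm g" for n
    by (intro AE_I2) (simp split: split_indicator)
qed

lemma stft_energy_tendsto:
  assumes L2: "\<And>n. f n \<in> L2" and bd: "\<And>n. l2_norm (f n) \<le> 1"
    and G: "\<And>z. (\<lambda>n. stft (f n) z) \<longlonglongrightarrow> G z"
  shows "(\<lambda>n. stft_energy (f n)) \<longlonglongrightarrow> (LINT z:U|lborel. (cmod (G z))\<^sup>2)"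
  unfolding stft_energy_def set_lebesgue_integral_def
proof (rule integral_dominated_convergence[where w="\<lambda>z. indicator U z *\<^sub>R 1"])
  note [measurable] = borel_measurable_stft[OF L2]
  have [measurable]: "G \<in> borel_measurable borel"
    by (rule borel_measurable_LIMSEQ_metric[OF _ G]) measurable
  show "(\<lambda>z. indicator U z *\<^sub>R (cmod (G z))\<^sup>2) \<in> borel_measurable lborel" by measurable
  show "(\<lambda>z. indicator U z *\<^sub>R (cmod (stft (f n) z))\<^sup>2) \<in> borel_measurable lborel" for n
    by measurable
  show "integrable lborel (\<lambda>z. indicator U z *\<^sub>R (1::real))"
    using set_integrable_bounded[of "\<lambda>_. 1::real" 1] by (simp add: set_integrable_def)
  show "AE z in lborel. (\<lambda>n. indicator U z *\<^sub>R (cmod (stft (f n) z))\<^sup>2)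
      \<longlonglongrightarrow> indicator U z *\<^sub>R (cmod (G z))\<^sup>2"
    by (intro AE_I2 tendsto_intros G)
  have "(cmod (stft (f n) z))\<^sup>2 \<le> 1" for n z
    using stft_bound[OF L2, of n z] bd[of n] by (intro power_le_one) auto
  then show "AE z in lborel. norm (indicator U z *\<^sub>R (cmod (stft (f n) z))\<^sup>2) \<le> indicator U z *\<^sub>R 1" for n
    by (intro AE_I2) (simp split: split_indicator)
qed

text \<open>
  The Cauchy--Schwarz inequality for the nonnegative form \<open>M \<langle>f, g\<rangle> - \<langle>\<L>\<^sub>U f, g\<rangle>\<close>. When \<open>f\<close> nearly
  maximizes the energy the first factor is small, so \<open>f\<close> nearly satisfies the eigenvalue equation
  tested against \<open>g\<close>.
\<close>

lemma stft_form_near_maximum: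
  assumes max: "\<And>f. f \<in> L2 \<Longrightarrow> stft_energy f \<le> M * (l2_norm f)\<^sup>2" and fg: "f \<in> L2" "g \<in> L2"
  shows "(cmod (of_real M * l2_inner f g - stft_form U f g))\<^sup>2
    \<le> (M * (l2_norm f)\<^sup>2 - stft_energy f) * (M * (l2_norm g)\<^sup>2 - stft_energy g)"
proof (rule psd_form_discriminant)
  fix \<tau>
  have "Re (cnj \<tau> * (of_real M * l2_inner f g - stft_form U f g))
    = M * Re (cnj \<tau> * l2_inner f g) - Re (cnj \<tau> * stft_form U f g)"
    by (simp add: algebra_simps)
  then show "0 \<le> M * (l2_norm f)\<^sup>2 - stft_energy f
      + 2 * Re (cnj \<tau> * (of_real M * l2_inner f g - stft_form U f g))
      + (cmod \<tau>)\<^sup>2 * (M * (l2_norm g)\<^sup>2 - stft_energy g)"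
    using max[of "\<lambda>t. f t + \<tau> * g t"] fg
    by (simp add: stft_energy_add l2_norm_add_sq stft_energy_scale l2_norm_scale
        stft_form_scale_right l2_inner_scale_right power_mult_distrib algebra_simps)
qed (use max fg in simp)

text \<open>
  Compactness of the localization operator in explicit form. Along a maximizing sequence with
  \<open>stft (f n) \<longlonglongrightarrow> G\<close> pointwise, dominated convergence on \<open>U\<close>, which has finite measure, gives
  \<open>\<langle>\<L>\<^sub>U (f n), g\<rangle> \<longlonglongrightarrow> \<langle>h, g\<rangle>\<close> with \<open>h = synthesis U G\<close>. As the sequence nearly solves the eigenvalue
  equation, also \<open>M \<langle>f n, g\<rangle> \<longlonglongrightarrow> \<langle>h, g\<rangle>\<close>. With \<open>g\<close> an atom this identifies \<open>stft h = M G\<close>, which says both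
  that \<open>h\<close> is an eigenfunction and that its energy \<open>M\<^sup>2 \<integral>\<^sub>U \<bar>G\<bar>\<^sup>2 = M\<^sup>3\<close> is not zero.
\<close>

lemma rayleigh_maximizer:
  assumes pos: "0 < measure lborel U"
  obtains M h where "h \<in> L2" "0 < l2_norm h" "0 < M"
    "\<And>g. g \<in> L2 \<Longrightarrow> stft_form U h g = of_real M * l2_inner h g"
    "\<And>f. f \<in> L2 \<Longrightarrow> stft_energy f \<le> M * (l2_norm f)\<^sup>2"
proof -
  define S where "S = {stft_energy f | f. f \<in> L2 \<and> l2_norm f = 1}"
  define M where "M = Sup S"
  have bdd: "bdd_above S"
    unfolding S_def bdd_above_def using stft_energy_bound by force
  have inS: "stft_energy (gauss_at 0) \<in> S" unfolding S_def using l2_norm_gauss_at by blast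
  have M: "0 < M"
    using cSup_upper[OF inS bdd] stft_energy_gauss_at_pos[OF pos, of 0] by (simp add: M_def)
  have max: "stft_energy f \<le> M * (l2_norm f)\<^sup>2" if f: "f \<in> L2" for f
  proof (cases "l2_norm f = 0")
    case True then show ?thesis using stft_energy_bound[OF f] by simp
  next
    case False
    define u where "u = (\<lambda>t. of_real (1 / l2_norm f) * f t)"
    have "l2_norm u = cmod (of_real (1 / l2_norm f)) * l2_norm f"
      unfolding u_def by (rule l2_norm_scale)
    also have "\<dots> = 1" unfolding norm_of_real using False by simp
    finally have "l2_norm u = 1" .
    moreover have "u \<in> L2" unfolding u_def using f by (rule L2_scale)
    ultimately have "stft_energy u \<in> S" by (auto simp: S_def)
    then have "stft_energy u \<le> M" using cSup_upper bdd by (simp add: M_def)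
    moreover have "stft_energy u = stft_energy f / (l2_norm f)\<^sup>2"
      unfolding u_def stft_energy_scale norm_of_real using False by (simp add: power_divide)
    ultimately show ?thesis using False by (simp add: field_simps)
  qed
  have "\<exists>f. f \<in> L2 \<and> l2_norm f = 1 \<and> M - 1 / real (Suc n) < stft_energy f" for n
  proof -
    have "M - 1 / real (Suc n) < Sup S" by (simp add: M_def)
    then obtain r where "r \<in> S" "M - 1 / real (Suc n) < r"
      using less_cSup_iff[of S "M - 1 / real (Suc n)"] inS bdd by auto
    then show ?thesis by (auto simp: S_def)
  qed
  then obtain f0 where f0: "\<And>n. f0 n \<in> L2" "\<And>n. l2_norm (f0 n) = 1"
    "\<And>n. M - 1 / real (Suc n) < stft_energy (f0 n)" by metis
  obtain k G where k: "strict_mono (k :: nat \<Rightarrow> nat)" and G: "\<And>z. (\<lambda>n. stft (f0 (k n)) z) \<longlonglongrightarrow> G z"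
    using stft_pointwise_convergent_subsequence[of f0] f0 by (metis order_refl)
  define f where "f n = f0 (k n)" for n
  have f: "\<And>n. f n \<in> L2" "\<And>n. l2_norm (f n) = 1" and fG: "\<And>z. (\<lambda>n. stft (f n) z) \<longlonglongrightarrow> G z"
    using f0 G by (auto simp: f_def)
  have en_f: "(\<lambda>n. stft_energy (f n)) \<longlonglongrightarrow> M"
  proof (rule tendsto_sandwich)
    show "\<forall>\<^sub>F n in sequentially. M - 1 / real (Suc n) \<le> stft_energy (f n)"
    proof (intro always_eventually allI)
      fix n
      have "real (Suc n) \<le> real (Suc (k n))" using seq_suble[OF k, of n] by simp
      then have "1 / real (Suc (k n)) \<le> 1 / real (Suc n)" by (intro divide_left_mono) auto
      then show "M - 1 / real (Suc n) \<le> stft_energy (f n)"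
        using f0(3)[of "k n"] unfolding f_def by linarith
    qed
    show "\<forall>\<^sub>F n in sequentially. stft_energy (f n) \<le> M"
      using max f by (intro always_eventually allI) (metis mult.right_neutral one_power2)
    show "(\<lambda>n. M - 1 / real (Suc n)) \<longlonglongrightarrow> M"
      using tendsto_diff[OF tendsto_const LIMSEQ_inverse_real_of_nat, of M] by (simp add: inverse_eq_divide)
  qed simp
  have Gm: "G \<in> borel_measurable borel"
    by (rule borel_measurable_LIMSEQ_metric[OF _ fG]) (rule borel_measurable_stft[OF f(1)])
  have G1: "cmod (G z) \<le> 1" for z
    by (rule LIMSEQ_le_const2[OF tendsto_norm[OF fG]]) (use stft_bound[OF f(1)] f(2) in auto)
  define h where "h = synthesis U G"
  have h: "h \<in> L2" unfolding h_def by (rule synthesis_L2[OF Gm G1])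
  have hg: "l2_inner h g = (LINT z:U|lborel. G z * cnj (stft g z))" if "g \<in> L2" for g
    unfolding h_def by (rule synthesis_inner[OF Gm G1 that])
  have weak: "(\<lambda>n. of_real M * l2_inner (f n) g) \<longlonglongrightarrow> l2_inner h g" if g: "g \<in> L2" for g
  proof -
    have "(\<lambda>n. of_real M * l2_inner (f n) g - stft_form U (f n) g) \<longlonglongrightarrow> 0"
    proof (rule tendsto_norm_zero_cancel, rule tendsto_sandwich[OF _ _ tendsto_const])
      let ?c = "M * (l2_norm g)\<^sup>2 - stft_energy g"
      show "\<forall>\<^sub>F n in sequentially. norm (of_real M * l2_inner (f n) g - stft_form U (f n) g)
          \<le> sqrt ((M - stft_energy (f n)) * ?c)"
        using stft_form_near_maximum[OF max f(1) g] f(2)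
        by (intro always_eventually allI real_le_rsqrt) simp
      have "(\<lambda>n. sqrt ((M - stft_energy (f n)) * ?c)) \<longlonglongrightarrow> sqrt ((M - M) * ?c)"
        by (intro tendsto_intros en_f)
      then show "(\<lambda>n. sqrt ((M - stft_energy (f n)) * ?c)) \<longlonglongrightarrow> 0" by simp
    qed simp
    from tendsto_add[OF this stft_form_tendsto[OF f(1) g _ fG]]
    show ?thesis by (simp add: hg[OF g] f(2))
  qed
  have Vh: "stft h z = of_real M * G z" for z
  proof (rule LIMSEQ_unique)
    show "(\<lambda>n. of_real M * stft (f n) z) \<longlonglongrightarrow> stft h z"
      unfolding stft_eq_inner by (rule weak) simp
    show "(\<lambda>n. of_real M * stft (f n) z) \<longlonglongrightarrow> of_real M * G z"
      by (intro tendsto_intros fG)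
  qed
  have "stft_energy h = M\<^sup>2 * (LINT z:U|lborel. (cmod (G z))\<^sup>2)"
    unfolding stft_energy_def Vh by (simp add: norm_mult power_mult_distrib)
  also have "(LINT z:U|lborel. (cmod (G z))\<^sup>2) = M"
    by (rule LIMSEQ_unique[OF stft_energy_tendsto[OF f(1) _ fG] en_f]) (simp add: f(2))
  finally have "stft_energy h > 0" using M by simp
  then have "l2_norm h \<noteq> 0" using stft_energy_bound[OF h] by auto
  then have "0 < l2_norm h" using l2_norm_nonneg[of h] by linarith
  moreover have "stft_form U h g = of_real M * l2_inner h g" if "g \<in> L2" for g
    unfolding hg[OF that] stft_form_def Vh by (simp add: mult.assoc)
  ultimately show thesis using that h M max by blast
qed

lemma stft_form_lebesgue:
  assumes "f \<in> L2" "g \<in> L2"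
  shows "(LINT z:U|lebesgue. stft f z * cnj (stft g z)) = stft_form U f g"
proof -
  note [measurable] = borel_measurable_stft[OF assms(1)] borel_measurable_stft[OF assms(2)]
  show ?thesis unfolding stft_form_def by (rule set_integral_lebesgue_lborel) measurable
qed

lemma loc_eigenfunction_iff:
  "loc_eigenfunction U \<mu> f \<longleftrightarrow>
    f \<in> L2 \<and> 0 < l2_norm f \<and> (\<forall>g\<in>L2. stft_form U f g = \<mu> * l2_inner f g)"
  unfolding loc_eigenfunction_def loc_op_def
  using l2_norm_eq_0_iff[of f] l2_norm_nonneg[of f]
  by (auto simp: stft_form_lebesgue l2_inner_scale_left less_le)

lemma stft_energy_eigenfunction:
  assumes "loc_eigenfunction U (of_real \<mu>) f"
  shows "stft_energy f = \<mu> * (l2_norm f)\<^sup>2"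
proof -
  have "stft_form U f f = of_real \<mu> * l2_inner f f"
    using assms unfolding loc_eigenfunction_iff by blast
  then have "complex_of_real (stft_energy f) = of_real (\<mu> * (l2_norm f)\<^sup>2)"
    unfolding stft_form_self l2_inner_self by simp
  then show ?thesis by (simp only: of_real_eq_iff)
qed

text \<open>
  The variational characterization of the largest eigenvalue; in particular the greatest element in
  its definition exists.
\<close>

lemma lambda1_maximal:
  assumes pos: "0 < measure lborel U"
  shows "loc_eigenvalue U (of_real (lambda1 U))"
    and "\<And>f. f \<in> L2 \<Longrightarrow> stft_energy f \<le> lambda1 U * (l2_norm f)\<^sup>2"
proof -
  obtain M h where h: "h \<in> L2" "0 < l2_norm h" "\<And>g. g \<in> L2 \<Longrightarrow> stft_form U h g = of_real M * l2_inner h g"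
    and max: "\<And>f. f \<in> L2 \<Longrightarrow> stft_energy f \<le> M * (l2_norm f)\<^sup>2"
    using rayleigh_maximizer[OF pos] by metis
  have ev: "loc_eigenvalue U (of_real M)"
    unfolding loc_eigenvalue_def loc_eigenfunction_iff using h by blast
  have "lambda1 U = M"
    unfolding lambda1_def
  proof (rule Greatest_equality)
    show "loc_eigenvalue U (complex_of_real M)" by (rule ev)
  next
    fix r assume "loc_eigenvalue U (of_real r)"
    then obtain f where f: "loc_eigenfunction U (of_real r) f" unfolding loc_eigenvalue_def by blast
    then have "f \<in> L2" "0 < l2_norm f" by (auto simp: loc_eigenfunction_iff)
    then show "r \<le> M" using stft_energy_eigenfunction[OF f] max[of f] by simp
  qed
  with ev max show "loc_eigenvalue U (of_real (lambda1 U))"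
    "\<And>f. f \<in> L2 \<Longrightarrow> stft_energy f \<le> lambda1 U * (l2_norm f)\<^sup>2" by simp_all
qed

end

section \<open>Discs\<close>

text \<open>
  Discs about the origin are indexed by their area, because the area \<open>a\<close> is also the exponent in the
  eigenvalue \<open>1 - exp (- a)\<close>.
\<close>

definition area_disc :: "real \<Rightarrow> (real \<times> real) set" where
  "area_disc a = {z. pi * (norm z)\<^sup>2 \<le> a}"

lemma area_disc_eq_cball:
  assumes "0 \<le> a" shows "area_disc a = cball 0 (sqrt (a / pi))"
proof -
  have "pi * (norm z)\<^sup>2 \<le> a \<longleftrightarrow> norm z \<le> sqrt (a / pi)" for z :: "real \<times> real"
  proof -
    have "pi * (norm z)\<^sup>2 \<le> a \<longleftrightarrow> (norm z)\<^sup>2 \<le> a / pi" by (simp add: field_simps)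
    also have "\<dots> \<longleftrightarrow> norm z \<le> sqrt (a / pi)"
      by (metis norm_ge_zero real_le_rsqrt real_sqrt_le_iff real_sqrt_pow2_iff real_sqrt_power real_sqrt_abs abs_norm_cancel)
    finally show ?thesis .
  qed
  then show ?thesis by (auto simp: area_disc_def mem_cball dist_0_norm)
qed

lemma closed_area_disc: "closed (area_disc a)"
  unfolding area_disc_def by (intro closed_Collect_le continuous_intros)

lemma borel_area_disc [measurable]: "area_disc a \<in> sets borel"
  using closed_area_disc by (rule borel_closed)

lemma emeasure_area_disc: "0 \<le> a \<Longrightarrow> emeasure lborel (area_disc a) = ennreal a"
  by (simp add: area_disc_eq_cball emeasure_cball unit_ball_vol_2 power_divide)

lemma measure_area_disc: "0 \<le> a \<Longrightarrow> measure lborel (area_disc a) = a"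
  by (simp add: measure_def emeasure_area_disc)

lemma area_disc_mono: "a \<le> b \<Longrightarrow> area_disc a \<subseteq> area_disc b"
  by (auto simp: area_disc_def)

lemma plane_domain_area_disc: "0 \<le> a \<Longrightarrow> plane_domain (area_disc a)"
  by standard (auto simp: emeasure_area_disc)

lemma norm_Complex: "cmod (Complex (fst z) (snd z)) = norm z" for z :: "real \<times> real"
  by (cases z) (simp add: cmod_def norm_Pair)

lemma constant_of_quadratic_modulus:
  fixes J :: "real \<Rightarrow> real"
  assumes "convex S" and J: "\<And>x y. x \<in> S \<Longrightarrow> y \<in> S \<Longrightarrow> \<bar>J y - J x\<bar> \<le> (y - x)\<^sup>2"
  shows "\<exists>c. \<forall>x\<in>S. J x = c"
proof (rule has_field_derivative_zero_constant[OF \<open>convex S\<close>])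
  fix x assume x: "x \<in> S"
  have "((\<lambda>y. (J y - J x) / (y - x)) \<longlongrightarrow> 0) (at x within S)"
  proof (rule tendsto_norm_zero_cancel, rule tendsto_sandwich[OF _ _ tendsto_const])
    show "\<forall>\<^sub>F y in at x within S. norm ((J y - J x) / (y - x)) \<le> \<bar>y - x\<bar>"
    proof (unfold eventually_at_filter, intro always_eventually allI impI)
      fix y assume "y \<noteq> x" "y \<in> S"
      then show "norm ((J y - J x) / (y - x)) \<le> \<bar>y - x\<bar>"
        using J[OF x, of y] by (simp add: field_simps power2_eq_square abs_mult_self_eq flip: abs_mult)
    qed
    have "((\<lambda>y. \<bar>y - x\<bar>) \<longlongrightarrow> \<bar>x - x\<bar>) (at x within S)" by (intro tendsto_intros)
    then show "((\<lambda>y. \<bar>y - x\<bar>) \<longlongrightarrow> 0) (at x within S)" by simp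
  qed simp
  then show "(J has_field_derivative 0) (at x within S)"
    by (simp add: has_field_derivative_iff)
qed

lemma borel_measurable_gaussian_weight [measurable]:
  "(\<lambda>z::real \<times> real. exp (- pi * (norm z)\<^sup>2)) \<in> borel_measurable borel"
  by (intro borel_measurable_continuous_onI continuous_intros)

lemma exp_minus_chord:
  fixes a b :: real assumes "0 \<le> a" "a \<le> b"
  shows "exp (- a) - exp (- b) \<le> b - a" "(b - a) * exp (- b) \<le> exp (- a) - exp (- b)"
    "exp (- a) - exp (- b) \<le> (b - a) * exp (- a)"
proof -
  have "1 - exp (- (b - a)) \<le> b - a" using exp_ge_add_one_self[of "- (b - a)"] by linarith
  then have "exp (- a) * (1 - exp (- (b - a))) \<le> exp (- a) * (b - a)" by (intro mult_left_mono) auto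
  then show 3: "exp (- a) - exp (- b) \<le> (b - a) * exp (- a)"
    by (simp add: algebra_simps exp_add[symmetric])
  have "(b - a) * exp (- a) \<le> (b - a) * 1" using assms by (intro mult_left_mono) auto
  with 3 show "exp (- a) - exp (- b) \<le> b - a" by simp
  have "b - a \<le> exp (b - a) - 1" using exp_ge_add_one_self[of "b - a"] by linarith
  then have "exp (- b) * (b - a) \<le> exp (- b) * (exp (b - a) - 1)" by (intro mult_left_mono) auto
  then show "(b - a) * exp (- b) \<le> exp (- a) - exp (- b)"
    by (simp add: algebra_simps exp_add[symmetric])
qed

lemma gaussian_weight_annulus:
  fixes A :: "(real \<times> real) set"
  assumes [measurable]: "A \<in> sets borel" and A: "\<And>z. z \<in> A \<Longrightarrow> a \<le> pi * (norm z)\<^sup>2 \<and> pi * (norm z)\<^sup>2 \<le> b"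
    and fin: "emeasure lborel A < \<infinity>"
  shows "measure lborel A * exp (- b) \<le> (LINT z:A|lborel. exp (- pi * (norm z)\<^sup>2))"
    and "(LINT z:A|lborel. exp (- pi * (norm z)\<^sup>2)) \<le> measure lborel A * exp (- a)"
proof -
  interpret plane_domain A by standard (use fin in auto)
  have int: "set_integrable lborel A (\<lambda>z. exp (- pi * (norm z)\<^sup>2))"
    by (rule set_integrable_bounded[where K=1]) auto
  have c: "set_integrable lborel A (\<lambda>z. k)" for k :: real
    by (rule set_integrable_bounded[where K="\<bar>k\<bar>"]) auto
  have "(LINT z:A|lborel. exp (- b)) \<le> (LINT z:A|lborel. exp (- pi * (norm z)\<^sup>2))"
    by (intro set_integral_mono int c) (use A in auto)
  then show "measure lborel A * exp (- b) \<le> (LINT z:A|lborel. exp (- pi * (norm z)\<^sup>2))"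
    using fin by (simp add: set_integral_const)
  have "(LINT z:A|lborel. exp (- pi * (norm z)\<^sup>2)) \<le> (LINT z:A|lborel. exp (- a))"
    by (intro set_integral_mono int c) (use A in auto)
  then show "(LINT z:A|lborel. exp (- pi * (norm z)\<^sup>2)) \<le> measure lborel A * exp (- a)"
    using fin by (simp add: set_integral_const)
qed

text \<open>
  On the annulus between the areas \<open>x \<le> y\<close> the weight lies between \<open>exp (- y)\<close> and \<open>exp (- x)\<close>. Hence the
  two sides have the same derivative in \<open>a\<close>, and they agree at \<open>a = 0\<close>.
\<close>

lemma gaussian_weight_area_disc:
  assumes "0 \<le> a"
  shows "(LINT z:area_disc a|lborel. exp (- pi * (norm z)\<^sup>2)) = 1 - exp (- a)"
proof -
  define I where "I a = (LINT z:area_disc a|lborel. exp (- pi * (norm z)\<^sup>2))" for a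
  define J where "J a = I a + exp (- a)" for a
  have step: "\<bar>J y - J x\<bar> \<le> (y - x)\<^sup>2" if xy: "0 \<le> x" "x \<le> y" for x y
  proof -
    let ?A = "area_disc y - area_disc x"
    interpret plane_domain "area_disc y" by (rule plane_domain_area_disc) (use xy in simp)
    have sub: "area_disc x \<subseteq> area_disc y" using xy by (intro area_disc_mono)
    have int: "set_integrable lborel (area_disc y) (\<lambda>z. exp (- pi * (norm z)\<^sup>2))"
      by (rule set_integrable_bounded[where K=1]) auto
    have "I y = (LINT z:area_disc x \<union> ?A|lborel. exp (- pi * (norm z)\<^sup>2))"
      unfolding I_def using sub by (simp add: Un_absorb1)
    also have "\<dots> = I x + (LINT z:?A|lborel. exp (- pi * (norm z)\<^sup>2))"
      unfolding I_def by (intro set_integral_Un set_integrable_subset[OF int] Diff_disjoint) (use sub in auto)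
    finally have I: "I y - I x = (LINT z:?A|lborel. exp (- pi * (norm z)\<^sup>2))" by simp
    have m: "measure lborel ?A = y - x"
      using xy sub by (subst measure_Diff) (auto simp: measure_area_disc emeasure_area_disc)
    have fin: "emeasure lborel ?A < \<infinity>"
      using finite_U emeasure_mono[of ?A "area_disc y" lborel] by (auto simp: order.strict_trans1)
    have *: "(y - x) * exp (- y) \<le> I y - I x" "I y - I x \<le> (y - x) * exp (- x)"
      unfolding I m[symmetric]
      by (rule gaussian_weight_annulus[OF _ _ fin, of x y]; auto simp: area_disc_def)+
    have **: "(y - x) * (exp (- x) - exp (- y)) \<le> (y - x) * (y - x)"
      using xy exp_minus_chord(1)[OF xy] by (intro mult_left_mono) auto
    show ?thesis
    proof -
      have sq: "(y - x)\<^sup>2 = (y - x) * (y - x)" by (rule power2_eq_square)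
      have J: "J y - J x = (I y - I x) - (exp (- x) - exp (- y))" by (simp add: J_def)
      have d: "(y - x) * (exp (- x) - exp (- y)) = (y - x) * exp (- x) - (y - x) * exp (- y)"
        by (rule right_diff_distrib)
      show ?thesis
        using * ** exp_minus_chord(2,3)[OF xy] unfolding abs_le_iff sq J d by linarith
    qed
  qed
  have J_const: "\<bar>J y - J x\<bar> \<le> (y - x)\<^sup>2" if "x \<in> {0..}" "y \<in> {0..}" for x y
  proof (cases "x \<le> y")
    case True then show ?thesis using step[of x y] that by simp
  next
    case False
    then have "\<bar>J x - J y\<bar> \<le> (x - y)\<^sup>2" using step[of y x] that by simp
    then show ?thesis by (subst abs_minus_commute, subst power2_commute)
  qed
  have "\<exists>c. \<forall>x\<in>{0..}. J x = c"
    by (rule constant_of_quadratic_modulus[OF convex_real_interval(1) J_const])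
  then obtain c where c: "\<And>x. 0 \<le> x \<Longrightarrow> J x = c" by auto
  have "I 0 = 0"
  proof (rule antisym)
    have fin: "emeasure lborel (area_disc 0) < \<infinity>" by (simp add: emeasure_area_disc)
    have "0 \<le> pi * (norm z)\<^sup>2 \<and> pi * (norm z)\<^sup>2 \<le> 0" if "z \<in> area_disc 0" for z
      using that unfolding area_disc_def by simp
    from gaussian_weight_annulus[OF borel_area_disc this fin]
    show "I 0 \<le> 0" "0 \<le> I 0"
      unfolding I_def measure_area_disc[OF order_refl] by auto
  qed
  then have "J a = 1" using c[of 0] c[OF assms] by (simp add: J_def)
  then show ?thesis by (simp add: J_def I_def)
qed

lemma norm_pair_sq: "(norm (x, y))\<^sup>2 = x\<^sup>2 + y\<^sup>2" for x y :: real
  by (simp add: norm_Pair)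

text \<open>
  A line at height \<open>y\<close> meets the disc in a chord, and \<open>K\<close> vanishes at its two endpoints.
\<close>

lemma chord_FTC:
  fixes K k :: "real \<Rightarrow> complex"
  assumes K: "\<And>x. (K has_vector_derivative k x) (at x)" and k: "continuous_on UNIV k"
    and zero: "\<And>x. pi * (x\<^sup>2 + y\<^sup>2) = a \<Longrightarrow> K x = 0"
  shows "(LINT x|lborel. indicator {x. pi * (x\<^sup>2 + y\<^sup>2) \<le> a} x *\<^sub>R k x) = 0"
proof (cases "pi * y\<^sup>2 \<le> a")
  case False
  have "\<not> pi * (x\<^sup>2 + y\<^sup>2) \<le> a" for x
  proof -
    have "pi * (x\<^sup>2 + y\<^sup>2) = pi * x\<^sup>2 + pi * y\<^sup>2" "0 \<le> pi * x\<^sup>2" by (simp_all add: distrib_left)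
    then show ?thesis using False by linarith
  qed
  then show ?thesis by simp
next
  case True
  define c where "c = sqrt (a / pi - y\<^sup>2)"
  have nn: "0 \<le> a / pi - y\<^sup>2" using True by (simp add: field_simps)
  then have c: "c\<^sup>2 = a / pi - y\<^sup>2" "0 \<le> c" by (simp_all add: c_def)
  have "pi * (x\<^sup>2 + y\<^sup>2) \<le> a \<longleftrightarrow> x \<in> {-c..c}" for x
  proof -
    have "pi * (x\<^sup>2 + y\<^sup>2) \<le> a \<longleftrightarrow> x\<^sup>2 \<le> c\<^sup>2" unfolding c by (simp add: field_simps)
    also have "\<dots> \<longleftrightarrow> \<bar>x\<bar> \<le> c" using c(2) by (metis abs_le_square_iff abs_of_nonneg)
    finally show ?thesis by auto
  qed
  then have "(LINT x|lborel. indicator {x. pi * (x\<^sup>2 + y\<^sup>2) \<le> a} x *\<^sub>R k x)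
      = (LINT x|lborel. indicator {-c..c} x *\<^sub>R k x)"
    by (simp add: indicator_def)
  also have "\<dots> = K c - K (- c)"
    using c(2) by (intro integral_FTC_Icc has_vector_derivative_at_within[OF K] continuous_on_subset[OF k]) auto
  also have "\<dots> = 0" using zero[of c] zero[of "- c"] c by simp
  finally show ?thesis .
qed

text \<open>
  Green's theorem for a disc. With \<open>K = (exp (- \<pi> \<bar>z\<bar>\<^sup>2) - exp (- a)) h\<close>, which vanishes on the boundary
  circle, the Cauchy--Riemann equations give \<open>(\<partial>\<^sub>x + \<i> \<partial>\<^sub>y) K = - 2 \<pi> z exp (- \<pi> \<bar>z\<bar>\<^sup>2) h\<close>; both partial
  derivatives integrate to zero along chords.
\<close>

lemma holomorphic_moment_area_disc:
  assumes h: "h holomorphic_on UNIV" and a: "0 \<le> a"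
  shows "(LINT z:area_disc a|lborel. of_real (exp (- pi * (norm z)\<^sup>2)) *
      (Complex (fst z) (snd z) * h (Complex (fst z) (snd z)))) = 0"
proof -
  define E where "E = (\<lambda>x y. exp (- pi * (x\<^sup>2 + y\<^sup>2)) :: real)"
  define K where "K x y = of_real (E x y - exp (- a)) * h (Complex x y)" for x y
  define K1 where "K1 x y = of_real (- 2 * pi * x * E x y) * h (Complex x y)
    + of_real (E x y - exp (- a)) * deriv h (Complex x y)" for x y
  define K2 where "K2 x y = of_real (- 2 * pi * y * E x y) * h (Complex x y)
    + of_real (E x y - exp (- a)) * (\<i> * deriv h (Complex x y))" for x y
  have dh: "(h has_field_derivative deriv h w) (at w)" for w
    using h holomorphic_derivI by blast
  have ch: "continuous_on UNIV h" "continuous_on UNIV (deriv h)"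
    using h by (auto intro!: holomorphic_on_imp_continuous_on holomorphic_deriv)
  have cC: "continuous_on UNIV (\<lambda>z::real \<times> real. Complex (fst z) (snd z))"
    unfolding Complex_eq by (intro continuous_intros)
  have c2: "continuous_on UNIV (\<lambda>z::real \<times> real. h (Complex (fst z) (snd z)))"
    "continuous_on UNIV (\<lambda>z::real \<times> real. deriv h (Complex (fst z) (snd z)))"
    using continuous_on_compose2[OF ch(1) cC] continuous_on_compose2[OF ch(2) cC] by auto
  have cK1: "continuous_on UNIV (\<lambda>z. K1 (fst z) (snd z))"
    unfolding K1_def E_def by (intro continuous_intros c2)
  have cK2: "continuous_on UNIV (\<lambda>z. K2 (fst z) (snd z))"
    unfolding K2_def E_def by (intro continuous_intros c2)
  have cpt: "compact (area_disc a)" using a by (simp add: area_disc_eq_cball)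
  have int: "integrable lborel (\<lambda>z. indicator (area_disc a) z *\<^sub>R F z)"
    if F: "continuous_on UNIV F" for F :: "real \<times> real \<Rightarrow> complex"
    by (rule borel_integrable_compact[OF cpt]) (use F continuous_on_subset in blast)
  have Ex: "((\<lambda>x. of_real (E x y - exp (- a))) has_vector_derivative (of_real (- 2 * pi * x * E x y) :: complex)) (at x)" for x y
    unfolding E_def has_real_derivative_iff_has_vector_derivative[symmetric]
    by (rule has_vector_derivative_of_real, auto intro!: derivative_eq_intros)
  have Ey: "((\<lambda>y. of_real (E x y - exp (- a))) has_vector_derivative (of_real (- 2 * pi * y * E x y) :: complex)) (at y)" for x y
    using Ex[of x y] unfolding E_def
    by (rule_tac has_vector_derivative_of_real, auto intro!: derivative_eq_intros)
  have hx: "((\<lambda>x. h (Complex x y)) has_vector_derivative deriv h (Complex x y)) (at x)" for x y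
  proof -
    have "((\<lambda>x. Complex x y) has_vector_derivative 1) (at x)"
      unfolding Complex_eq by (auto intro!: derivative_eq_intros)
    from field_vector_diff_chain_at[OF this dh] show ?thesis by (simp add: o_def)
  qed
  have hy: "((\<lambda>y. h (Complex x y)) has_vector_derivative \<i> * deriv h (Complex x y)) (at y)" for x y
  proof -
    have "((\<lambda>y. Complex x y) has_vector_derivative \<i>) (at y)"
      unfolding Complex_eq by (auto intro!: derivative_eq_intros)
    from field_vector_diff_chain_at[OF this dh] show ?thesis by (simp add: o_def)
  qed
  have K1: "((\<lambda>x. K x y) has_vector_derivative K1 x y) (at x)" for x y
    unfolding K_def K1_def using has_vector_derivative_mult[OF Ex hx] by (simp add: add.commute)
  have K2: "((\<lambda>y. K x y) has_vector_derivative K2 x y) (at y)" for x y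
    unfolding K_def K2_def using has_vector_derivative_mult[OF Ey hy] by (simp add: add.commute)
  have zero: "K x y = 0" if "pi * (x\<^sup>2 + y\<^sup>2) = a" for x y
    using that by (simp add: K_def E_def)
  have ind: "indicator (area_disc a) (x, y) = indicator {x. pi * (x\<^sup>2 + y\<^sup>2) \<le> a} x"
    "indicator (area_disc a) (x, y) = indicator {y. pi * (y\<^sup>2 + x\<^sup>2) \<le> a} y" for x y :: real
    by (auto simp: area_disc_def indicator_def norm_pair_sq add.commute)
  have slice: "continuous_on UNIV (\<lambda>x. F (x, y))" "continuous_on UNIV (\<lambda>y. F (x, y))"
    if "continuous_on UNIV F" for F :: "real \<times> real \<Rightarrow> complex" and x y
    using that by (auto intro!: continuous_on_compose2[OF that] continuous_intros)
  have I1: "(LINT z|lborel. indicator (area_disc a) z *\<^sub>R K1 (fst z) (snd z)) = 0"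
  proof -
    have "(LINT z|lborel. indicator (area_disc a) z *\<^sub>R K1 (fst z) (snd z))
        = (LINT y|lborel. LINT x|lborel. indicator (area_disc a) (x, y) *\<^sub>R K1 x y)"
      using lborel_pair.integral_snd[of "\<lambda>x y. indicator (area_disc a) (x, y) *\<^sub>R K1 x y"] int[OF cK1]
      unfolding lborel_prod case_prod_unfold by simp
    also have "\<dots> = (LINT y|lborel. (0 :: complex))"
      unfolding ind(1) using chord_FTC[OF K1 slice(1)[OF cK1, simplified] zero] by simp
    finally show ?thesis by simp
  qed
  have I2: "(LINT z|lborel. indicator (area_disc a) z *\<^sub>R K2 (fst z) (snd z)) = 0"
  proof -
    have "(LINT z|lborel. indicator (area_disc a) z *\<^sub>R K2 (fst z) (snd z))
        = (LINT x|lborel. LINT y|lborel. indicator (area_disc a) (x, y) *\<^sub>R K2 x y)"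
      using lborel_pair.integral_fst[of "\<lambda>x y. indicator (area_disc a) (x, y) *\<^sub>R K2 x y"] int[OF cK2]
      unfolding lborel_prod case_prod_unfold by simp
    also have "\<dots> = (LINT x|lborel. (0 :: complex))"
      unfolding ind(2) using chord_FTC[OF K2 slice(2)[OF cK2, simplified]] zero by (simp add: add.commute)
    finally show ?thesis by simp
  qed
  have "of_real (- 2 * pi) * (LINT z:area_disc a|lborel. of_real (exp (- pi * (norm z)\<^sup>2)) *
      (Complex (fst z) (snd z) * h (Complex (fst z) (snd z))))
    = (LINT z|lborel. indicator (area_disc a) z *\<^sub>R K1 (fst z) (snd z)
        + \<i> * (indicator (area_disc a) z *\<^sub>R K2 (fst z) (snd z)))"
    unfolding set_lebesgue_integral_def integral_mult_right_zero[symmetric]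
  proof (rule Bochner_Integration.integral_cong[OF refl])
    fix z :: "real \<times> real"
    have "exp (- pi * (norm z)\<^sup>2) = E (fst z) (snd z)"
      unfolding E_def by (cases z) (simp add: norm_pair_sq)
    then show "of_real (- 2 * pi) * (indicator (area_disc a) z *\<^sub>R (of_real (exp (- pi * (norm z)\<^sup>2)) *
      (Complex (fst z) (snd z) * h (Complex (fst z) (snd z)))))
     = indicator (area_disc a) z *\<^sub>R K1 (fst z) (snd z) + \<i> * (indicator (area_disc a) z *\<^sub>R K2 (fst z) (snd z))"
      unfolding K1_def K2_def Complex_eq
      by (auto simp: indicator_def algebra_simps)
  qed
  also have "\<dots> = 0"
    by (subst Bochner_Integration.integral_add[OF int[OF cK1] integrable_mult_right[OF int[OF cK2]]])
      (simp only: I1 integral_mult_right_zero I2, simp)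
  finally show ?thesis by simp
qed

text \<open>
  The mean value property for a radial weight, obtained by dividing \<open>H - H 0\<close> by \<open>z\<close>.
\<close>

lemma gaussian_mean_value_area_disc:
  assumes H: "H holomorphic_on UNIV" and a: "0 \<le> a"
  shows "(LINT z:area_disc a|lborel. of_real (exp (- pi * (norm z)\<^sup>2)) * H (Complex (fst z) (snd z)))
    = of_real (1 - exp (- a)) * H 0"
proof -
  interpret plane_domain "area_disc a" using a by (rule plane_domain_area_disc)
  (* the singularity of the difference quotient at 0 is removable *)
  define h where "h w = (if w = 0 then deriv H 0 else (H w - H 0) / (w - 0))" for w
  have h: "h holomorphic_on UNIV" unfolding h_def by (rule pole_lemma_open[OF H]) simp
  have split: "H w = w * h w + H 0" for w by (simp add: h_def)
  have cpt: "compact (area_disc a)" using a by (simp add: area_disc_eq_cball)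
  have "continuous_on UNIV (\<lambda>z::real \<times> real. Complex (fst z) (snd z))"
    unfolding Complex_eq by (intro continuous_intros)
  from continuous_on_compose2[OF holomorphic_on_imp_continuous_on[OF h] this]
  have c: "continuous_on UNIV (\<lambda>z::real \<times> real. of_real (exp (- pi * (norm z)\<^sup>2)) *
      (Complex (fst z) (snd z) * h (Complex (fst z) (snd z))))"
    unfolding Complex_eq by (intro continuous_intros) auto
  have int: "set_integrable lborel (area_disc a) F" if F: "continuous_on UNIV F" for F :: "real \<times> real \<Rightarrow> complex"
    unfolding set_integrable_def
    by (rule borel_integrable_compact[OF cpt]) (use F continuous_on_subset in blast)
  have int2: "set_integrable lborel (area_disc a) (\<lambda>z. of_real (exp (- pi * (norm z)\<^sup>2)) * H 0)"
    by (rule int) (intro continuous_intros)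
  have "(LINT z:area_disc a|lborel. of_real (exp (- pi * (norm z)\<^sup>2)) * H (Complex (fst z) (snd z)))
    = (LINT z:area_disc a|lborel. of_real (exp (- pi * (norm z)\<^sup>2)) *
      (Complex (fst z) (snd z) * h (Complex (fst z) (snd z))))
     + (LINT z:area_disc a|lborel. of_real (exp (- pi * (norm z)\<^sup>2)) * H 0)"
    by (subst set_integral_add(2)[OF int[OF c] int2, symmetric], subst split) (simp add: distrib_left)
  also have "\<dots> = (LINT z:area_disc a|lborel. of_real (exp (- pi * (norm z)\<^sup>2))) * H 0"
    unfolding holomorphic_moment_area_disc[OF h a] by simp
  also have "(LINT z:area_disc a|lborel. complex_of_real (exp (- pi * (norm z)\<^sup>2)))
      = of_real (LINT z:area_disc a|lborel. exp (- pi * (norm z)\<^sup>2))"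
    by (rule set_integral_complex_of_real)
  finally show ?thesis unfolding gaussian_weight_area_disc[OF a] .
qed

text \<open>
  The Gaussian is an eigenfunction of the localization operator of a centred disc: for fixed \<open>t\<close>, the
  integrand \<open>stft \<phi> z * gauss_at z t\<close> is the radial weight \<open>exp (- \<pi> \<bar>z\<bar>\<^sup>2)\<close> times an entire function
  of \<open>z\<close>, and the mean value property evaluates the integral at \<open>z = 0\<close>.
\<close>

lemma stft_form_area_disc_gauss:
  assumes g: "g \<in> L2" and a: "0 \<le> a"
  shows "stft_form (area_disc a) (gauss_at 0) g = of_real (1 - exp (- a)) * l2_inner (gauss_at 0) g"
proof -
  interpret plane_domain "area_disc a" using a by (rule plane_domain_area_disc)
  define H where "H t w = of_real (2 powr (1/4) * exp (- pi * t\<^sup>2)) * exp (- (of_real pi / 2) * w\<^sup>2 + 2 * of_real pi * of_real t * w)" for t :: real and w :: complex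
  have H: "H t holomorphic_on UNIV" for t unfolding H_def by (intro holomorphic_intros)
  have "synthesis (area_disc a) (stft (gauss_at 0)) = (\<lambda>t. of_real (1 - exp (- a)) * gauss_at 0 t)"
  proof
    fix t
    have "stft (gauss_at 0) z * gauss_at (Complex (fst z) (snd z)) t
        = of_real (exp (- pi * (norm z)\<^sup>2)) * H t (Complex (fst z) (snd z))" for z
    proof -
      obtain x y where z: "z = (x, y)" by (cases z)
      have e: "of_real (- pi * (x\<^sup>2 + y\<^sup>2) / 2) + \<i> * of_real (pi * (0 - y) * (0 + x)) + of_real (- pi * (t - x)\<^sup>2)
          + \<i> * of_real (2 * pi * y * t)
        = of_real (- pi * (x\<^sup>2 + y\<^sup>2)) + of_real (- pi * t\<^sup>2)
          + (- (of_real pi / 2) * (Complex x y)\<^sup>2 + 2 * of_real pi * of_real t * Complex x y)"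
        by (simp add: complex_eq_iff power2_eq_square field_simps)
      have "stft (gauss_at 0) z * gauss_at (Complex (fst z) (snd z)) t
        = of_real (2 powr (1/4)) * exp (of_real (- pi * (x\<^sup>2 + y\<^sup>2) / 2) + \<i> * of_real (pi * (0 - y) * (0 + x)) + of_real (- pi * (t - x)\<^sup>2)
          + \<i> * of_real (2 * pi * y * t))"
        unfolding stft_gauss_at gauss_at_eq exp_add
        by (simp add: z norm_pair_sq cmod_power2 exp_of_real[symmetric])
      also have "\<dots> = of_real (exp (- pi * (norm z)\<^sup>2)) * H t (Complex (fst z) (snd z))"
        unfolding e unfolding exp_add H_def by (simp add: z norm_pair_sq exp_of_real[symmetric] exp_add)
      finally show ?thesis .
    qed
    then have "synthesis (area_disc a) (stft (gauss_at 0)) t = of_real (1 - exp (- a)) * H t 0"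
      unfolding synthesis_def by (simp only: gaussian_mean_value_area_disc[OF H a])
    then show "synthesis (area_disc a) (stft (gauss_at 0)) t = of_real (1 - exp (- a)) * gauss_at 0 t"
      by (simp add: H_def gauss_at_eq)
  qed
  moreover have "l2_inner (synthesis (area_disc a) (stft (gauss_at 0))) g = stft_form (area_disc a) (gauss_at 0) g"
    unfolding stft_form_def
    by (rule synthesis_inner[OF borel_measurable_stft[OF gauss_at_L2] _ g, where K=1])
      (use stft_bound[OF gauss_at_L2] in simp)
  ultimately show ?thesis by (simp add: l2_inner_scale_left)
qed

section \<open>Domains close to a disc: the deficit is quadratic\<close>

context plane_domain
begin

lemma stft_energy_gauss_at_0:
  "stft_energy (gauss_at 0) = (LINT z:U|lborel. exp (- pi * (norm z)\<^sup>2))"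
  unfolding stft_energy_gauss_at by (simp add: norm_Complex)

text \<open>
  For \<open>g\<close> orthogonal to the Gaussian, the atom at \<open>z\<close> may be replaced by its component orthogonal to
  the Gaussian, whose squared norm is \<open>1 - exp (- \<pi> \<bar>z\<bar>\<^sup>2)\<close>.
\<close>

lemma stft_orthogonal_bound:
  assumes g: "g \<in> L2" and orth: "l2_inner (gauss_at 0) g = 0"
  shows "(cmod (stft g z))\<^sup>2 \<le> (l2_norm g)\<^sup>2 * (1 - exp (- pi * (norm z)\<^sup>2))"
proof -
  let ?p = "gauss_at (Complex (fst z) (snd z))"
  define c where "c = l2_inner ?p (gauss_at 0)"
  have c2: "(cmod c)\<^sup>2 = exp (- pi * (norm z)\<^sup>2)"
    unfolding c_def gauss_inner by (simp add: norm_mult exp_double[symmetric] norm_Complex)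
  have orth': "l2_inner g (gauss_at 0) = 0"
    by (subst l2_inner_commute) (simp add: orth)
  have L: "(\<lambda>t. ?p t - c * gauss_at 0 t) \<in> L2" by auto
  have "stft g z = l2_inner g (\<lambda>t. ?p t - c * gauss_at 0 t)"
    unfolding stft_eq_inner using g by (simp add: l2_inner_diff_right l2_inner_scale_right orth')
  then have "cmod (stft g z) \<le> l2_norm g * l2_norm (\<lambda>t. ?p t - c * gauss_at 0 t)"
    using l2_Cauchy_Schwarz[OF g L] by simp
  then have "(cmod (stft g z))\<^sup>2 \<le> (l2_norm g)\<^sup>2 * (l2_norm (\<lambda>t. ?p t - c * gauss_at 0 t))\<^sup>2"
    unfolding power_mult_distrib[symmetric] by (intro power_mono) auto
  also have "(l2_norm (\<lambda>t. ?p t - c * gauss_at 0 t))\<^sup>2 = 1 - 2 * Re (cnj c * c) + (cmod c)\<^sup>2"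
    by (subst l2_norm_diff_sq) (auto simp: l2_norm_scale l2_inner_scale_right c_def)
  also have "Re (cnj c * c) = (cmod c)\<^sup>2" by (simp add: cmod_power2) (simp add: power2_eq_square)
  finally show ?thesis by (simp add: c2)
qed

text \<open>
  The spectral gap. On domains of area \<open>1\<close> close to a disc the Gaussian has energy about
  \<open>1 - exp (- 1) > 1/2\<close>, so that its orthogonal complement has strictly smaller energy.
\<close>

lemma stft_energy_orthogonal:
  assumes g: "g \<in> L2" and orth: "l2_inner (gauss_at 0) g = 0"
  shows "stft_energy g \<le> (measure lborel U - stft_energy (gauss_at 0)) * (l2_norm g)\<^sup>2"
proof -
  note [measurable] = borel_measurable_stft[OF g]
  have i1: "set_integrable lborel U (\<lambda>z. (cmod (stft g z))\<^sup>2)"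
    by (rule set_integrable_bounded[where K="(l2_norm g)\<^sup>2"])
      (measurable, use stft_bound[OF g] in \<open>simp add: power_mono\<close>)
  have i2: "set_integrable lborel U (\<lambda>z. exp (- pi * (norm z)\<^sup>2))"
    by (rule set_integrable_bounded[where K=1]) auto
  have i3: "set_integrable lborel U (\<lambda>z. 1::real)"
    by (rule set_integrable_bounded[where K=1]) auto
  have "stft_energy g \<le> (LINT z:U|lborel. (l2_norm g)\<^sup>2 * (1 - exp (- pi * (norm z)\<^sup>2)))"
    unfolding stft_energy_def
    by (rule set_integral_mono[OF i1 set_integrable_mult_right[OF set_integral_diff(1)[OF i3 i2]] stft_orthogonal_bound[OF g orth]])
  also have "\<dots> = (l2_norm g)\<^sup>2 * (measure lborel U - stft_energy (gauss_at 0))"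
    unfolding stft_energy_gauss_at_0
    by (subst set_integral_mult_right, subst set_integral_diff(2)[OF i3 i2])
      (use finite_U in \<open>simp add: set_integral_const\<close>)
  finally show ?thesis by (simp add: mult.commute)
qed

end

text \<open>
  Domains of area \<open>1\<close> squeezed between two concentric discs. The area is fixed because a function
  \<open>K\<close> of the area is constant along the family to be built. The bound \<open>1/10\<close> on the width leaves
  room for the spectral gap.
\<close>

locale near_disc = plane_domain +
  fixes a b :: real
  assumes a_nonneg: "0 \<le> a" and inner: "area_disc a \<subseteq> U" and outer: "U \<subseteq> area_disc b"
    and unit_area: "measure lborel U = 1" and thin: "b - a \<le> 1 / 10"
begin

lemma b_nonneg: "0 \<le> b"
proof (rule ccontr)
  assume "\<not> 0 \<le> b"
  then have "area_disc b = {}"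
    unfolding area_disc_def by (auto simp: not_le intro: order_less_le_trans)
  then show False using outer unit_area by auto
qed

lemma radii: "a \<le> 1" "1 \<le> b"
proof -
  have "measure lborel (area_disc a) \<le> measure lborel U"
    using inner finite_U by (intro measure_mono_fmeasurable fmeasurableI) (auto simp: emeasure_area_disc[OF a_nonneg])
  then show "a \<le> 1" by (simp add: measure_area_disc[OF a_nonneg] unit_area)
  have "measure lborel U \<le> measure lborel (area_disc b)"
    using outer by (intro measure_mono_fmeasurable fmeasurableI) (auto simp: emeasure_area_disc[OF b_nonneg])
  then show "1 \<le> b" by (simp add: measure_area_disc[OF b_nonneg] unit_area)
qed

definition rim :: "(real \<times> real) set" where "rim = U - area_disc a"

lemma borel_rim [measurable]: "rim \<in> sets borel" unfolding rim_def by measurable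

lemma finite_rim: "emeasure lborel rim < \<infinity>"
  using finite_U emeasure_mono[of rim U lborel] by (auto simp: rim_def order.strict_trans1)

lemma measure_rim: "measure lborel rim = 1 - a"
  unfolding rim_def using inner finite_U
  by (subst measure_Diff) (auto simp: unit_area measure_area_disc[OF a_nonneg])

lemma rim_annulus: "z \<in> rim \<Longrightarrow> a \<le> pi * (norm z)\<^sup>2 \<and> pi * (norm z)\<^sup>2 \<le> b"
  using outer unfolding rim_def area_disc_def by auto

lemma set_integral_split:
  fixes F :: "real \<times> real \<Rightarrow> 'b::{banach, second_countable_topology}"
  assumes "set_integrable lborel U F"
  shows "(LINT z:U|lborel. F z) = (LINT z:area_disc a|lborel. F z) + (LINT z:rim|lborel. F z)"
proof -
  have "U = area_disc a \<union> rim" using inner by (auto simp: rim_def)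
  moreover have "(LINT z:area_disc a \<union> rim|lborel. F z) = (LINT z:area_disc a|lborel. F z) + (LINT z:rim|lborel. F z)"
    by (intro set_integral_Un set_integrable_subset[OF assms]) (use inner in \<open>auto simp: rim_def\<close>)
  ultimately show ?thesis by simp
qed

abbreviation gauss_energy :: real where "gauss_energy \<equiv> stft_energy (gauss_at 0)"

text \<open>
  First-order changes cancel: replacing the disc of area \<open>1\<close> by \<open>U\<close> moves a mass of size at most
  \<open>b - a\<close> across the boundary, within a zone on which the Gaussian weight varies only by \<open>O(b - a)\<close>.
\<close>

lemma gauss_energy_near_optimal: "\<bar>gauss_energy - (1 - exp (- 1))\<bar> \<le> (b - a)\<^sup>2"
proof -
  have int: "set_integrable lborel U (\<lambda>z. exp (- pi * (norm z)\<^sup>2))"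
    by (rule set_integrable_bounded[where K=1]) auto
  define r where "r = (LINT z:rim|lborel. exp (- pi * (norm z)\<^sup>2))"
  have q: "gauss_energy = (1 - exp (- a)) + r"
    unfolding stft_energy_gauss_at_0 r_def set_integral_split[OF int] gaussian_weight_area_disc[OF a_nonneg] ..
  have r: "(1 - a) * exp (- b) \<le> r" "r \<le> (1 - a) * exp (- a)"
    using gaussian_weight_annulus[OF borel_rim rim_annulus finite_rim] unfolding r_def measure_rim by auto
  have e: "(1 - a) * exp (- 1) \<le> exp (- a) - exp (- 1)" "exp (- a) - exp (- 1) \<le> (1 - a) * exp (- a)"
    using exp_minus_chord[OF a_nonneg radii(1)] by auto
  have "(1 - a) * (exp (- a) - exp (- b)) \<le> (b - a) * (b - a)"
    using radii exp_minus_chord(1)[OF a_nonneg, of b] by (intro mult_mono) auto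
  moreover have "(1 - a) * (exp (- a) - exp (- 1)) \<le> (b - a) * (b - a)"
    using radii exp_minus_chord(1)[OF a_nonneg radii(1)] by (intro mult_mono) auto
  ultimately show ?thesis
    using q r e unfolding abs_le_iff power2_eq_square[of "b - a"] right_diff_distrib[of "1 - a"] by linarith
qed

lemma exp_minus_1_bound: "exp (- 1 :: real) \<le> 3 / 8"
proof -
  have "5837465777 / 2147483648 - inverse (2 ^ 32) \<le> exp (1::real)" using e_approx_32 by linarith
  then have "exp (1::real) \<ge> 8 / 3" by simp
  then show ?thesis by (simp add: exp_minus field_simps)
qed

lemma gauss_energy_ge: "3 / 5 \<le> gauss_energy"
proof -
  have "(b - a)\<^sup>2 \<le> (1 / 10)\<^sup>2" using thin radii by (intro power_mono) auto
  then show ?thesis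
    using gauss_energy_near_optimal exp_minus_1_bound by (simp add: abs_le_iff power2_eq_square)
qed

text \<open>
  On the inner disc the Gaussian is an eigenfunction, so only the rim couples it to its orthogonal
  complement. This coupling is of first order in the width.
\<close>

lemma stft_form_gauss_orthogonal:
  assumes g: "g \<in> L2" and orth: "l2_inner (gauss_at 0) g = 0"
  shows "stft_form U (gauss_at 0) g = stft_form rim (gauss_at 0) g"
    and "cmod (stft_form U (gauss_at 0) g) \<le> (1 - a) * l2_norm g"
proof -
  show *: "stft_form U (gauss_at 0) g = stft_form rim (gauss_at 0) g"
    using set_integral_split[OF stft_form_integrable[OF gauss_at_L2 g]] stft_form_area_disc_gauss[OF g a_nonneg]
    by (simp add: stft_form_def orth)
  interpret rim: plane_domain rim by standard (use finite_rim in auto)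
  show "cmod (stft_form U (gauss_at 0) g) \<le> (1 - a) * l2_norm g"
    unfolding * using rim.stft_form_bound[OF gauss_at_L2 g] by (simp add: measure_rim)
qed

text \<open>
  Second-order perturbation theory: with \<open>f = \<alpha> \<phi> + g\<close> and \<open>g\<close> orthogonal to \<open>\<phi>\<close>, the coupling
  \<open>2 m \<parallel>g\<parallel>\<close> is first order, but the gap \<open>2 q - 1 \<ge> 1/5\<close> makes it pay \<open>(2 q - 1) \<parallel>g\<parallel>\<^sup>2\<close>, so that the gain is
  at most \<open>m\<^sup>2 / (2 q - 1)\<close>.
\<close>

lemma stft_energy_upper_bound:
  assumes f: "f \<in> L2" "l2_norm f = 1"
  shows "stft_energy f \<le> gauss_energy + 5 * (b - a)\<^sup>2"
proof -
  define \<alpha> where "\<alpha> = l2_inner f (gauss_at 0)"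
  define g where "g = (\<lambda>t. f t - \<alpha> * gauss_at 0 t)"
  have g: "g \<in> L2" unfolding g_def using f by auto
  have "l2_inner g (gauss_at 0) = 0"
    unfolding g_def using f l2_inner_self[of "gauss_at 0"]
    by (simp add: l2_inner_diff_left l2_inner_scale_left \<alpha>_def)
  then have orth: "l2_inner (gauss_at 0) g = 0" by (subst l2_inner_commute) simp
  have fe: "f = (\<lambda>t. \<alpha> * gauss_at 0 t + g t)" by (simp add: g_def)
  define x y q m where "x = cmod \<alpha>" and "y = l2_norm g" and "q = gauss_energy" and "m = 1 - a"
  have "(l2_norm f)\<^sup>2 = x\<^sup>2 + y\<^sup>2"
    unfolding fe using g by (subst l2_norm_add_sq) (auto simp: l2_norm_scale l2_inner_scale_left orth x_def y_def)
  then have xy: "x\<^sup>2 = 1 - y\<^sup>2" using f by simp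
  then have "x\<^sup>2 \<le> 1\<^sup>2" by simp
  then have x: "0 \<le> x" "x \<le> 1" using power2_le_imp_le[of x 1] by (auto simp: x_def)
  have y: "0 \<le> y" by (simp add: y_def)
  have m: "0 \<le> m" "m \<le> b - a" using radii by (auto simp: m_def)
  have q: "3 / 5 \<le> q" using gauss_energy_ge by (simp add: q_def)
  have "stft_energy f = x\<^sup>2 * q + 2 * Re (\<alpha> * stft_form U (gauss_at 0) g) + stft_energy g"
    unfolding fe using g by (subst stft_energy_add) (auto simp: stft_energy_scale stft_form_scale_left x_def q_def)
  also have "Re (\<alpha> * stft_form U (gauss_at 0) g) \<le> x * (m * y)"
    using complex_Re_le_cmod[of "\<alpha> * stft_form U (gauss_at 0) g"]
      mult_left_mono[OF stft_form_gauss_orthogonal(2)[OF g orth], of x]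
    by (simp add: norm_mult x_def m_def y_def)
  also have "x * (m * y) \<le> 1 * (m * y)" using x m y by (intro mult_right_mono) auto
  also have "stft_energy g \<le> (1 - q) * y\<^sup>2"
    using stft_energy_orthogonal[OF g orth] by (simp add: unit_area q_def y_def)
  finally have "stft_energy f \<le> x\<^sup>2 * q + 2 * (1 * (m * y)) + (1 - q) * y\<^sup>2" by simp
  also have "\<dots> = q + 2 * (m * y) - (2 * q - 1) * y\<^sup>2"
    unfolding xy by (simp add: algebra_simps)
  also have "\<dots> \<le> q + 2 * (m * y) - (1 / 5) * y\<^sup>2"
    using q by (intro diff_left_mono mult_right_mono) auto
  also have "\<dots> \<le> q + 5 * m\<^sup>2"
    using zero_le_power2[of "5 * m - y"] by (simp add: power2_diff power_mult_distrib)
  also have "\<dots> \<le> q + 5 * (b - a)\<^sup>2" using m by (intro add_left_mono mult_left_mono power_mono) auto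
  finally show ?thesis by (simp add: q_def)
qed

lemma lambda1_bounds: "gauss_energy \<le> lambda1 U" "lambda1 U \<le> gauss_energy + 5 * (b - a)\<^sup>2" "lambda1 U \<le> 1"
proof -
  have pos: "0 < measure lborel U" by (simp add: unit_area)
  show "gauss_energy \<le> lambda1 U"
    using lambda1_maximal(2)[OF pos gauss_at_L2[of 0]] by simp
  obtain f where f: "loc_eigenfunction U (of_real (lambda1 U)) f"
    using lambda1_maximal(1)[OF pos] unfolding loc_eigenvalue_def by blast
  then have fL: "f \<in> L2" "0 < l2_norm f" by (auto simp: loc_eigenfunction_iff)
  define u where "u = (\<lambda>t. of_real (1 / l2_norm f) * f t)"
  have u: "u \<in> L2" "l2_norm u = 1"
    unfolding u_def using fL by (auto simp only: l2_norm_scale norm_of_real intro!: L2_scale) simp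
  have e: "stft_energy u = lambda1 U"
    unfolding u_def stft_energy_scale stft_energy_eigenfunction[OF f] norm_of_real
    using fL by (simp add: power_divide)
  show "lambda1 U \<le> gauss_energy + 5 * (b - a)\<^sup>2" "lambda1 U \<le> 1"
    using stft_energy_upper_bound[OF u] stft_energy_bound[OF u(1)] by (simp_all add: e u unit_area)
qed

text \<open>
  The estimate is two-sided because real powers satisfy \<open>(- x) powr \<beta> = x powr \<beta>\<close>: a negative deficit
  would contribute its absolute value. Proving this bound for the given domains takes the place of
  the Faber--Krahn inequality.
\<close>

lemma abs_deficit_le: "\<bar>deficit U\<bar> \<le> 10 * (b - a)\<^sup>2"
proof -
  define k where "k = 1 - exp (- 1 :: real)"
  have k: "3 / 5 \<le> k" using exp_minus_1_bound by (simp add: k_def)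
  have "\<bar>k - lambda1 U\<bar> \<le> 6 * (b - a)\<^sup>2"
    using lambda1_bounds gauss_energy_near_optimal by (simp add: k_def abs_le_iff)
  moreover have "deficit U = (k - lambda1 U) / k"
    using k borel_U by (simp add: deficit_def k_def unit_area diff_divide_distrib)
  ultimately have "\<bar>deficit U\<bar> \<le> 6 * (b - a)\<^sup>2 / k"
    using k by (simp add: abs_divide divide_right_mono)
  also have "\<dots> \<le> 6 * (b - a)\<^sup>2 / (3 / 5)" using k by (intro divide_left_mono) auto
  finally show ?thesis by simp
qed

end

section \<open>Symmetric domains: even eigenfunctions\<close>

lemma lebesgue_distr_uminus: "distr lebesgue lebesgue uminus = (lebesgue :: real measure)"
  using lebesgue_real_scale[of "-1"] by (simp add: density_1)

lemma lborel_distr_uminus_plane: "distr lborel borel uminus = (lborel :: (real \<times> real) measure)"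
  using lborel_affine[of "-1" "0 :: real \<times> real"] by (simp add: density_1)

lemma measurable_uminus_lebesgue: "uminus \<in> lebesgue \<rightarrow>\<^sub>M (lebesgue :: real measure)"
proof -
  have "(uminus :: real \<Rightarrow> real) = (*\<^sub>R) (- 1)" by (simp add: fun_eq_iff)
  then show ?thesis using lebesgue_measurable_scaling[of "-1" , where 'a=real] by (simp only:)
qed

lemma lebesgue_integral_reflect:
  fixes f :: "real \<Rightarrow> 'b::{banach, second_countable_topology}"
  assumes "f \<in> borel_measurable lebesgue"
  shows "(LINT t|lebesgue. f (- t)) = (LINT t|lebesgue. f t)"
  using integral_distr[OF measurable_uminus_lebesgue assms] by (simp add: lebesgue_distr_uminus)

lemma L2_reflect [simp, intro]:
  assumes "f \<in> L2" shows "(\<lambda>t. f (- t)) \<in> L2"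
proof -
  have f: "f \<in> borel_measurable lebesgue" using assms by (rule L2_measurable)
  have "(\<lambda>t. f (- t)) \<in> borel_measurable lebesgue"
    using measurable_compose[OF measurable_uminus_lebesgue f] .
  moreover have "integrable (distr lebesgue lebesgue uminus) (\<lambda>t. (cmod (f t))\<^sup>2)"
    using assms by (simp add: lebesgue_distr_uminus L2_def)
  then have "integrable lebesgue (\<lambda>t. (cmod (f (- t)))\<^sup>2)"
    by (rule integrable_distr[OF measurable_uminus_lebesgue])
  ultimately show ?thesis by (simp add: L2_def)
qed

lemma l2_inner_reflect:
  assumes "f \<in> L2" "g \<in> L2"
  shows "l2_inner (\<lambda>t. f (- t)) g = l2_inner f (\<lambda>t. g (- t))"
proof -
  have "(\<lambda>t. f t * cnj (g (- t))) \<in> borel_measurable lebesgue"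
    using L2_integrable_mult[OF assms(1) L2_reflect[OF assms(2)]] by (rule borel_measurable_integrable)
  from lebesgue_integral_reflect[OF this] show ?thesis by (simp add: l2_inner_def)
qed

lemma l2_norm_reflect: "f \<in> L2 \<Longrightarrow> l2_norm (\<lambda>t. f (- t)) = l2_norm f"
  unfolding l2_norm_def
  by (subst lebesgue_integral_reflect[where f="\<lambda>t. (cmod (f t))\<^sup>2"]) (auto dest: L2_measurable)

lemma gauss_at_reflect: "gauss_at w (- t) = gauss_at (- w) t"
proof -
  have "(- t - Re w)\<^sup>2 = (t + Re w)\<^sup>2" by (simp add: power2_eq_square algebra_simps)
  then show ?thesis by (simp add: gauss_at_eq)
qed

lemma stft_reflect: "f \<in> L2 \<Longrightarrow> stft (\<lambda>t. f (- t)) z = stft f (- z)"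
proof -
  assume "f \<in> L2"
  moreover have "- Complex (fst z) (snd z) = Complex (fst (- z)) (snd (- z))"
    by (simp add: complex_eq_iff)
  ultimately show ?thesis
    by (simp add: stft_eq_inner l2_inner_reflect gauss_at_reflect)
qed

lemma (in plane_domain) stft_form_reflect:
  assumes sym: "uminus ` U = U" and "f \<in> L2" "g \<in> L2"
  shows "stft_form U (\<lambda>t. f (- t)) g = stft_form U f (\<lambda>t. g (- t))"
proof -
  note [measurable] = borel_measurable_stft[OF assms(2)] borel_measurable_stft[OF assms(3)]
  have m: "(\<lambda>z::real \<times> real. - z) \<in> borel \<rightarrow>\<^sub>M borel" by measurable
  have [measurable]: "(\<lambda>z. stft g (- z)) \<in> borel_measurable borel"
    by (rule measurable_compose[OF m]) measurable
  have "(LINT z|distr lborel borel uminus. indicator U z *\<^sub>R (stft f z * cnj (stft g (- z))))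
     = (LINT z|lborel. indicator U (- z) *\<^sub>R (stft f (- z) * cnj (stft g (- (- z)))))"
    by (rule integral_distr) measurable
  moreover have "- z \<in> U \<longleftrightarrow> z \<in> U" for z
    by (metis sym image_eqI minus_minus)
  then have "indicator U (- z) = (indicator U z :: real)" for z
    by (simp add: indicator_def)
  ultimately show ?thesis
    using assms unfolding stft_form_def set_lebesgue_integral_def
    by (simp add: stft_reflect lborel_distr_uminus_plane)
qed

text \<open>
  Recentring \<open>\<phi>\<^sub>w\<close> at the origin moves it no further, up to a phase, than reflecting it to \<open>\<phi>\<^sub>-\<^sub>w\<close>.
\<close>

lemma gauss_at_translate_dist:
  "(l2_norm (\<lambda>t. gauss_at w t - gauss_at (- w) t))\<^sup>2 = 2 - 2 * exp (- 2 * pi * (cmod w)\<^sup>2)"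
  "(l2_norm (\<lambda>t. gauss_at w t - exp (\<i> * of_real (pi * Im w * Re w)) * gauss_at 0 t))\<^sup>2
     = 2 - 2 * exp (- pi * (cmod w)\<^sup>2 / 2)"
proof -
  have "cmod (w - - w) = 2 * cmod w" by (simp add: norm_mult flip: mult_2)
  then show "(l2_norm (\<lambda>t. gauss_at w t - gauss_at (- w) t))\<^sup>2 = 2 - 2 * exp (- 2 * pi * (cmod w)\<^sup>2)"
    by (simp add: l2_norm_diff_sq gauss_inner power_mult_distrib)
  let ?c = "exp (\<i> * of_real (pi * Im w * Re w))"
  have "cnj ?c * ?c = 1" unfolding exp_cnj exp_add[symmetric] by simp
  then have "cnj ?c * (of_real r * ?c) = of_real r" for r
    by (simp add: mult.left_commute[of "cnj ?c"])
  then have "Re (cnj ?c * (of_real (exp (- pi * (cmod w)\<^sup>2 / 2)) * ?c)) = exp (- pi * (cmod w)\<^sup>2 / 2)"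
    by (simp only: Re_complex_of_real)
  then show "(l2_norm (\<lambda>t. gauss_at w t - ?c * gauss_at 0 t))\<^sup>2 = 2 - 2 * exp (- pi * (cmod w)\<^sup>2 / 2)"
    by (subst l2_norm_diff_sq) (auto simp: l2_norm_scale l2_inner_scale_right gauss_inner)
qed

context near_disc
begin

text \<open>
  The localization operator of a centrally symmetric domain commutes with the reflection
  \<open>f \<mapsto> f (- \<cdot>)\<close>, so the odd part of an eigenfunction satisfies the eigenvalue equation with the same
  eigenvalue. Odd functions are orthogonal to the Gaussian, and the spectral gap excludes this.
\<close>

lemma eigenfunction_even:
  assumes sym: "uminus ` U = U" and f: "loc_eigenfunction U (of_real (lambda1 U)) f"
  shows "l2_norm (\<lambda>t. f t - f (- t)) = 0"
proof -
  let ?o = "\<lambda>t. f t - f (- t)"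
  have fL: "f \<in> L2" and eig: "\<And>g. g \<in> L2 \<Longrightarrow> stft_form U f g = of_real (lambda1 U) * l2_inner f g"
    using f by (auto simp: loc_eigenfunction_iff)
  have oL: "?o \<in> L2" using fL by auto
  have "stft_form U ?o ?o = of_real (lambda1 U) * l2_inner ?o ?o"
  proof -
    have "stft_form U ?o ?o = stft_form U f ?o - stft_form U f (\<lambda>t. ?o (- t))"
      using fL oL by (simp add: stft_form_diff_left stft_form_reflect[OF sym fL oL] del: minus_minus)
    also have "\<dots> = of_real (lambda1 U) * (l2_inner f ?o - l2_inner f (\<lambda>t. ?o (- t)))"
      by (subst (1 2) eig) (use oL L2_reflect[OF oL] in \<open>auto simp: algebra_simps\<close>)
    also have "l2_inner f ?o - l2_inner f (\<lambda>t. ?o (- t)) = l2_inner ?o ?o"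
      using l2_inner_reflect[OF fL oL] l2_inner_diff_left[OF fL L2_reflect[OF fL] oL] by simp
    finally show ?thesis .
  qed
  then have "complex_of_real (stft_energy ?o) = of_real (lambda1 U * (l2_norm ?o)\<^sup>2)"
    unfolding stft_form_self l2_inner_self by simp
  then have e: "stft_energy ?o = lambda1 U * (l2_norm ?o)\<^sup>2" by (simp only: of_real_eq_iff)
  have "l2_inner (gauss_at 0) ?o = l2_inner (gauss_at 0) f - l2_inner (gauss_at 0) (\<lambda>t. f (- t))"
    using fL by (simp add: l2_inner_diff_right)
  also have "l2_inner (gauss_at 0) (\<lambda>t. f (- t)) = l2_inner (gauss_at 0) f"
    using l2_inner_reflect[OF gauss_at_L2[of 0] fL] by (simp add: gauss_at_reflect)
  finally have orth: "l2_inner (gauss_at 0) ?o = 0" by simp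
  have "lambda1 U * (l2_norm ?o)\<^sup>2 \<le> (1 - gauss_energy) * (l2_norm ?o)\<^sup>2"
    using stft_energy_orthogonal[OF oL orth] by (simp add: e unit_area)
  moreover have "1 - gauss_energy < lambda1 U" using gauss_energy_ge lambda1_bounds(1) by linarith
  ultimately show ?thesis
    using mult_strict_right_mono[of "1 - gauss_energy" "lambda1 U" "(l2_norm ?o)\<^sup>2"]
    by (cases "l2_norm ?o = 0") auto
qed

text \<open>
  Suppose that \<open>f\<close> is at distance \<open>\<delta>\<close> from a Gaussian centred at \<open>w\<close>. Since \<open>f\<close> is even, it is at the
  same distance from the one centred at \<open>- w\<close>; so these two are close, which forces \<open>w\<close> to be near the
  origin and \<open>f\<close> to be at distance \<open>O(\<delta>)\<close> from the centred Gaussian, whatever \<open>w\<close> was. The functional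
  \<open>X = \<langle>(\<L>\<^sub>U - \<lambda>) \<cdot>, g\<rangle>\<close> vanishes at \<open>f\<close> and has norm at most \<open>8\<close>, hence is \<open>O(\<delta>)\<close> at the Gaussian,
  where it equals \<open>\<langle>\<L>\<^sub>U \<phi>, g\<rangle>\<close>.
\<close>

lemma eigenfunction_distance:
  assumes sym: "uminus ` U = U" and f: "top_eigenfunction U f"
    and g: "g \<in> L2" "l2_inner (gauss_at 0) g = 0" "l2_norm g \<le> 4" and c: "cmod c = 1"
  shows "cmod (stft_form U (gauss_at 0) g) \<le> 24 * l2_norm (\<lambda>t. f t - c * gauss_at w t)"
proof -
  have eigf: "loc_eigenfunction U (of_real (lambda1 U)) f" and nf: "l2_norm f = 1"
    using f by (auto simp: top_eigenfunction_def)
  have fL: "f \<in> L2" using eigf by (simp add: loc_eigenfunction_iff)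
  define \<delta> where "\<delta> = l2_norm (\<lambda>t. f t - c * gauss_at w t)"
  define X where "X u = stft_form U u g - of_real (lambda1 U) * l2_inner u g" for u
  have Xf: "X f = 0" using eigf g(1) by (simp add: X_def loc_eigenfunction_iff)
  have Xbound: "cmod (X u) \<le> 8 * l2_norm u" if u: "u \<in> L2" for u
  proof -
    have "cmod (X u) \<le> cmod (stft_form U u g) + cmod (of_real (lambda1 U) * l2_inner u g)"
      unfolding X_def by (rule norm_triangle_ineq4)
    also have "\<dots> \<le> l2_norm u * l2_norm g + 1 * (l2_norm u * l2_norm g)"
      unfolding norm_mult norm_of_real
      using stft_form_bound[OF u g(1)] l2_Cauchy_Schwarz[OF u g(1)] lambda1_bounds(1,3) gauss_energy_ge
      by (intro add_mono mult_mono) (auto simp: unit_area)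
    also have "\<dots> \<le> 8 * l2_norm u"
      using mult_left_mono[OF g(3), of "l2_norm u"] by (simp add: mult_ac)
    finally show ?thesis .
  qed
  have X_diff: "X (\<lambda>t. u t - v t) = X u - X v" if "u \<in> L2" "v \<in> L2" for u v
    using that g(1) by (simp add: X_def stft_form_diff_left l2_inner_diff_left algebra_simps)
  have X_scale: "X (\<lambda>t. k * u t) = k * X u" for k u
    by (simp add: X_def stft_form_scale_left l2_inner_scale_left algebra_simps)
  let ?r = "\<lambda>t. f t - c * gauss_at w t"
  have rL: "?r \<in> L2" using fL by auto
  (* both Gaussians are within \<delta> of f, up to the common phase c *)
  have near: "l2_norm (\<lambda>t. gauss_at w t - gauss_at (- w) t) \<le> 2 * \<delta>"
  proof -
    let ?e = "\<lambda>t. f t - f (- t)" and ?r' = "\<lambda>t. - 1 * ?r t"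
    have eL: "?e \<in> L2" using fL by auto
    have rR: "(\<lambda>t. ?r (- t)) \<in> L2" using L2_reflect[OF rL] .
    have "c * (gauss_at w t - gauss_at (- w) t) = (?e t + ?r (- t)) + ?r' t" for t
      by (simp add: gauss_at_reflect algebra_simps)
    then have "l2_norm (\<lambda>t. c * (gauss_at w t - gauss_at (- w) t)) = l2_norm (\<lambda>t. (?e t + ?r (- t)) + ?r' t)"
      by simp
    also have "\<dots> \<le> l2_norm (\<lambda>t. ?e t + ?r (- t)) + l2_norm ?r'"
      by (rule l2_norm_triangle[OF L2_add[OF eL rR] L2_scale[OF rL]])
    also have "\<dots> \<le> (l2_norm ?e + l2_norm (\<lambda>t. ?r (- t))) + l2_norm ?r'"
      by (intro add_right_mono l2_norm_triangle[OF eL rR])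
    also have "l2_norm ?e = 0" by (rule eigenfunction_even[OF sym eigf])
    also have "l2_norm (\<lambda>t. ?r (- t)) = \<delta>" unfolding \<delta>_def by (rule l2_norm_reflect[OF rL])
    also have "l2_norm ?r' = \<delta>" unfolding \<delta>_def by (subst l2_norm_scale) simp
    finally show ?thesis by (simp add: l2_norm_scale c)
  qed
  (* the phase that brings \<phi>\<^sub>w closest to the centred Gaussian *)
  define k where "k = exp (\<i> * of_real (pi * Im w * Re w))"
  have k: "cmod k = 1" by (simp add: k_def)
  let ?s = "\<lambda>t. gauss_at w t - k * gauss_at 0 t"
  have sL: "?s \<in> L2" by auto
  have "l2_norm ?s \<le> 2 * \<delta>"
  proof -
    have "exp (- 2 * pi * (cmod w)\<^sup>2) \<le> exp (- pi * (cmod w)\<^sup>2 / 2)" by simp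
    then have "(l2_norm ?s)\<^sup>2 \<le> (l2_norm (\<lambda>t. gauss_at w t - gauss_at (- w) t))\<^sup>2"
      unfolding k_def gauss_at_translate_dist by linarith
    then have "l2_norm ?s \<le> l2_norm (\<lambda>t. gauss_at w t - gauss_at (- w) t)"
      by (rule power2_le_imp_le) simp
    with near show ?thesis by linarith
  qed
  have "X (\<lambda>t. c * gauss_at w t) = X f - X ?r"
    using X_diff[OF fL rL] by simp
  then have "c * X (gauss_at w) = - X ?r" by (simp add: X_scale Xf)
  then have "cmod (X (gauss_at w)) = cmod (X ?r)"
    using c by (metis mult_1 norm_minus_cancel norm_mult)
  then have Xw: "cmod (X (gauss_at w)) \<le> 8 * \<delta>" using Xbound[OF rL] by (simp add: \<delta>_def)
  have "X (\<lambda>t. k * gauss_at 0 t) = X (gauss_at w) - X ?s"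
    using X_diff[OF gauss_at_L2[of w] sL] by simp
  then have "cmod (k * X (gauss_at 0)) \<le> cmod (X (gauss_at w)) + cmod (X ?s)"
    by (simp add: X_scale norm_triangle_ineq4)
  also have "\<dots> \<le> 8 * \<delta> + 8 * (2 * \<delta>)"
    using Xw Xbound[OF sL] \<open>l2_norm ?s \<le> 2 * \<delta>\<close> by linarith
  finally have "cmod (X (gauss_at 0)) \<le> 24 * \<delta>" by (simp add: norm_mult k)
  then show ?thesis by (simp add: X_def g(2) \<delta>_def)
qed

end

section \<open>A probe for the quadrupole deformation\<close>

lemma Re_stft_gauss_product:
  assumes "Re w * Im w = 0"
  shows "Re (stft (gauss_at 0) (x, y) * cnj (stft (gauss_at w) (x, y)))
    = exp (- pi * (norm (x, y))\<^sup>2) * exp (- pi * (cmod w)\<^sup>2 / 2) *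
      (exp (pi * (x * Re w + y * Im w)) * cos (pi * (y * Re w - x * Im w)))"
proof -
  define u v where "u = Re w" and "v = Im w"
  have uv: "u * v = 0" using assms by (simp add: u_def v_def)
  have m: "- pi * (norm (x, y))\<^sup>2 / 2 + - pi * (cmod (w - Complex x y))\<^sup>2 / 2
      = - pi * (norm (x, y))\<^sup>2 + - pi * (cmod w)\<^sup>2 / 2 + pi * (x * u + y * v)"
  proof -
    have w: "(cmod (w - Complex x y))\<^sup>2 = (u - x)\<^sup>2 + (v - y)\<^sup>2" "(cmod w)\<^sup>2 = u\<^sup>2 + v\<^sup>2"
      by (simp_all add: cmod_power2 u_def v_def)
    show ?thesis unfolding norm_pair_sq w by (simp add: power2_eq_square field_simps)
  qed
  have ph: "pi * (0 - y) * (0 + x) - pi * (v - y) * (u + x) = pi * (y * u - x * v)"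
    using uv by (simp add: algebra_simps)
  have "stft (gauss_at 0) (x, y) * cnj (stft (gauss_at w) (x, y))
    = of_real (exp (- pi * (norm (x, y))\<^sup>2 / 2) * exp (- pi * (cmod (w - Complex x y))\<^sup>2 / 2))
      * exp (\<i> * of_real (pi * (0 - y) * (0 + x)) + - \<i> * of_real (pi * (v - y) * (u + x)))"
    unfolding stft_gauss_at exp_add complex_cnj_mult exp_cnj
    using norm_Complex[of "(x, y)"] by (simp add: u_def v_def)
  also have "\<i> * of_real (pi * (0 - y) * (0 + x)) + - \<i> * of_real (pi * (v - y) * (u + x))
      = \<i> * of_real (pi * (0 - y) * (0 + x) - pi * (v - y) * (u + x))"
    by (simp add: algebra_simps)
  also have "exp (- pi * (norm (x, y))\<^sup>2 / 2) * exp (- pi * (cmod (w - Complex x y))\<^sup>2 / 2)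
      = exp (- pi * (norm (x, y))\<^sup>2) * exp (- pi * (cmod w)\<^sup>2 / 2) * exp (pi * (x * u + y * v))"
    unfolding exp_add[symmetric] m ..
  finally show ?thesis
    unfolding ph by (simp add: Re_exp u_def v_def)
qed

text \<open>
  Four atoms on the coordinate axes, with alternating signs, respond to a quadrupole deformation of
  the disc. The response has angular frequency \<open>2\<close>, which no shift of the centre can imitate to
  first order. The radius \<open>1 / \<pi>\<close> removes the factor \<open>\<pi>\<close> from the hyperbolic functions below.
\<close>

definition cross_probe :: "real \<Rightarrow> complex" where
  "cross_probe t = (gauss_at (of_real (1 / pi)) t + gauss_at (of_real (- 1 / pi)) t)
    - (gauss_at (\<i> * of_real (1 / pi)) t + gauss_at (\<i> * of_real (- 1 / pi)) t)"

lemma cross_probe_L2: "cross_probe \<in> L2"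
  unfolding cross_probe_def[abs_def] by (intro L2_diff L2_add gauss_at_L2)

lemma cross_probe_norm: "l2_norm cross_probe \<le> 4"
proof -
  let ?p = "\<lambda>t. gauss_at (of_real (1 / pi)) t + gauss_at (of_real (- 1 / pi)) t"
  let ?m = "\<lambda>t. gauss_at (\<i> * of_real (1 / pi)) t + gauss_at (\<i> * of_real (- 1 / pi)) t"
  have L: "?p \<in> L2" "?m \<in> L2" "(\<lambda>t. - 1 * ?m t) \<in> L2" by (intro L2_scale L2_add gauss_at_L2)+
  have "l2_norm ?p \<le> 1 + 1" "l2_norm ?m \<le> 1 + 1"
    by (rule order_trans[OF l2_norm_triangle[OF gauss_at_L2 gauss_at_L2]], simp)+
  moreover have "l2_norm (\<lambda>t. ?p t + - 1 * ?m t) \<le> l2_norm ?p + l2_norm (\<lambda>t. - 1 * ?m t)"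
    by (rule l2_norm_triangle[OF L(1,3)])
  moreover have "l2_norm (\<lambda>t. - 1 * ?m t) = l2_norm ?m" by (subst l2_norm_scale) simp
  moreover have "cross_probe = (\<lambda>t. ?p t + - 1 * ?m t)" by (simp add: fun_eq_iff cross_probe_def)
  ultimately show ?thesis by simp
qed

lemma cross_probe_orthogonal: "l2_inner (gauss_at 0) cross_probe = 0"
  unfolding cross_probe_def[abs_def]
  by (simp add: l2_inner_diff_right l2_inner_add_right gauss_inner norm_divide norm_mult)

lemma Re_stft_cross_probe:
  "Re (stft (gauss_at 0) (x, y) * cnj (stft cross_probe (x, y)))
    = 2 * exp (- pi * (norm (x, y))\<^sup>2) * exp (- 1 / (2 * pi)) * (cosh x * cos y - cosh y * cos x)"
proof -
  let ?V = "\<lambda>w. Re (stft (gauss_at 0) (x, y) * cnj (stft (gauss_at w) (x, y)))"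
  have "stft cross_probe (x, y) = (stft (gauss_at (of_real (1 / pi))) (x, y) + stft (gauss_at (of_real (- 1 / pi))) (x, y))
    - (stft (gauss_at (\<i> * of_real (1 / pi))) (x, y) + stft (gauss_at (\<i> * of_real (- 1 / pi))) (x, y))"
    unfolding cross_probe_def[abs_def] by (simp add: stft_diff stft_add)
  then have "Re (stft (gauss_at 0) (x, y) * cnj (stft cross_probe (x, y)))
    = (?V (of_real (1 / pi)) + ?V (of_real (- 1 / pi))) - (?V (\<i> * of_real (1 / pi)) + ?V (\<i> * of_real (- 1 / pi)))"
    by (simp only: complex_cnj_add complex_cnj_diff distrib_left right_diff_distrib plus_complex.sel minus_complex.sel)
  also have "\<dots> = exp (- pi * (norm (x, y))\<^sup>2) * exp (- 1 / (2 * pi)) *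
     ((exp x * cos y + exp (- x) * cos y) - (exp y * cos x + exp (- y) * cos x))"
    by (subst (1 2 3 4) Re_stft_gauss_product)
      (simp_all add: norm_divide norm_mult power_divide power2_eq_square distrib_left right_diff_distrib mult.commute[of pi 2])
  also have "(exp x * cos y + exp (- x) * cos y) - (exp y * cos x + exp (- y) * cos x)
     = 2 * (cosh x * cos y - cosh y * cos x)"
    by (simp add: cosh_field_def field_simps)
  finally show ?thesis by simp
qed

text \<open>
  The difference is at least \<open>cosh y (cos y - cos x)\<close>, because \<open>cosh\<close> increases with \<open>\<bar>x\<bar>\<close>; and the
  double-angle formula bounds \<open>cos y - cos x\<close> from below by \<open>1 - cos (x / 2)\<close> when \<open>\<bar>y\<bar> \<le> \<bar>x\<bar> / 2\<close>.
\<close>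

lemma cosh_cos_cross_bound:
  fixes x y :: real
  assumes "\<bar>y\<bar> \<le> \<bar>x\<bar> / 2" "2 / 5 \<le> \<bar>x\<bar>" "\<bar>x\<bar> \<le> 1"
  shows "1 - cos (1 / 5) \<le> cosh x * cos y - cosh y * cos x"
proof -
  define X Y where "X = \<bar>x\<bar>" and "Y = \<bar>y\<bar>"
  have xy: "0 \<le> Y" "Y \<le> X / 2" "2 / 5 \<le> X" "X \<le> 1" using assms by (auto simp: X_def Y_def)
  have piX: "X \<le> pi" using xy pi_gt3 by linarith
  define c where "c = cos (X / 2)"
  have c: "0 \<le> c" unfolding c_def using xy pi_gt3 by (intro cos_ge_zero) auto
  have c5: "c \<le> cos (1 / 5)" unfolding c_def using xy piX by (intro cos_monotone_0_pi_le) auto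
  have cY: "c \<le> cos Y" unfolding c_def using xy piX by (intro cos_monotone_0_pi_le) auto
  have cX: "cos X = 2 * c\<^sup>2 - 1" unfolding c_def using cos_double_cos[of "X / 2"] by simp
  have c1: "c \<le> 1" by (simp add: c_def)
  have "c * c \<le> c * 1" using c c1 by (intro mult_left_mono)
  then have diff: "1 - c \<le> cos Y - cos X" using cY unfolding cX power2_eq_square by linarith
  have "cosh Y \<le> cosh X" using xy by (subst cosh_real_nonneg_le_iff) auto
  then have "cosh Y * cos Y \<le> cosh X * cos Y" using cY c by (intro mult_right_mono) auto
  moreover have "1 * (cos Y - cos X) \<le> cosh Y * (cos Y - cos X)"
    using diff c1 cosh_real_ge_1[of Y] by (intro mult_right_mono) auto
  ultimately have "1 - cos (1 / 5) \<le> cosh X * cos Y - cosh Y * cos X"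
    using diff c5 unfolding right_diff_distrib by linarith
  then show ?thesis by (simp add: X_def Y_def)
qed

text \<open>
  A symmetric pair of sectors about the first axis, on which the response of the probe is positive.
\<close>

definition double_cone :: "(real \<times> real) set" where
  "double_cone = {z. \<bar>snd z\<bar> \<le> \<bar>fst z\<bar> / 2}"

definition probe_constant :: real where
  "probe_constant = 2 * exp (- 11 / 10) * exp (- 1 / (2 * pi)) * (1 - cos (1 / 5))"

lemma probe_constant_pos: "0 < probe_constant"
proof -
  have "cos (1 / 5 :: real) < cos 0" using pi_gt3 by (intro cos_monotone_0_pi) auto
  then show ?thesis by (simp add: probe_constant_def)
qed

context near_disc
begin

text \<open>
  The probe sees only the rim, by orthogonality to the Gaussian, and there the real part of the
  integrand is bounded below by a positive constant, so nothing cancels.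
\<close>

lemma cross_probe_detects_rim:
  assumes cone: "rim \<subseteq> double_cone"
  shows "probe_constant * (1 - a) \<le> cmod (stft_form U (gauss_at 0) cross_probe)"
proof -
  interpret rim: plane_domain rim by standard (use finite_rim in auto)
  let ?F = "\<lambda>z. stft (gauss_at 0) z * cnj (stft cross_probe z)"
  have int: "set_integrable lborel rim ?F"
    by (rule rim.stft_form_integrable[OF gauss_at_L2 cross_probe_L2])
  have low: "probe_constant \<le> Re (?F z)" if z: "z \<in> rim" for z
  proof -
    obtain x y where zxy: "z = (x, y)" by (cases z)
    have n: "a \<le> pi * (x\<^sup>2 + y\<^sup>2)" "pi * (x\<^sup>2 + y\<^sup>2) \<le> b"
      using rim_annulus[OF z] unfolding zxy norm_pair_sq by auto
    have cn: "\<bar>y\<bar> \<le> \<bar>x\<bar> / 2" using cone z by (auto simp: zxy double_cone_def)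
    then have "\<bar>y\<bar>\<^sup>2 \<le> (\<bar>x\<bar> / 2)\<^sup>2" by (intro power_mono) auto
    then have y2: "y\<^sup>2 \<le> x\<^sup>2 / 4" by (simp add: power_divide)
    have ab: "9 / 10 \<le> a" "b \<le> 11 / 10" using thin radii by auto
    have "9 / 10 \<le> pi * (x\<^sup>2 + y\<^sup>2)" using n ab by linarith
    also have "\<dots> \<le> 4 * (x\<^sup>2 + y\<^sup>2)" using pi_less_4 by (intro mult_right_mono) auto
    finally have "(2 / 5)\<^sup>2 \<le> \<bar>x\<bar>\<^sup>2" using y2 by (simp add: power2_eq_square)
    then have x1: "2 / 5 \<le> \<bar>x\<bar>" by (rule power2_le_imp_le) simp
    have "3 * (x\<^sup>2 + y\<^sup>2) \<le> pi * (x\<^sup>2 + y\<^sup>2)" using pi_gt3 by (intro mult_right_mono) auto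
    then have "3 * x\<^sup>2 \<le> 11 / 10" using n ab zero_le_power2[of y] unfolding distrib_left by linarith
    then have "\<bar>x\<bar>\<^sup>2 \<le> 1\<^sup>2" by simp
    then have x2: "\<bar>x\<bar> \<le> 1" by (rule power2_le_imp_le) simp
    have "exp (- 11 / 10) \<le> exp (- pi * (norm z)\<^sup>2)"
      using n ab by (simp add: zxy norm_pair_sq)
    then have "(2 * exp (- 1 / (2 * pi))) * exp (- 11 / 10) * (1 - cos (1 / 5))
       \<le> (2 * exp (- 1 / (2 * pi))) * exp (- pi * (norm z)\<^sup>2) * (cosh x * cos y - cosh y * cos x)"
      using cosh_cos_cross_bound[OF cn x1 x2] by (intro mult_mono) auto
    then show ?thesis
      unfolding probe_constant_def zxy Re_stft_cross_probe by (simp add: mult_ac)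
  qed
  have "probe_constant * (1 - a) = (LINT z:rim|lborel. probe_constant)"
    using finite_rim by (simp add: set_integral_const measure_rim)
  also have "\<dots> \<le> (LINT z:rim|lborel. Re (?F z))"
  proof (rule set_integral_mono)
    show "set_integrable lborel rim (\<lambda>z. probe_constant)"
      by (rule rim.set_integrable_bounded[where K="\<bar>probe_constant\<bar>"]) auto
    have "integrable lborel (\<lambda>z. Re (indicator rim z *\<^sub>R ?F z))"
      using int unfolding set_integrable_def by (rule integrable_Re)
    then show "set_integrable lborel rim (\<lambda>z. Re (?F z))"
      by (simp add: set_integrable_def)
  qed (rule low)
  also have "\<dots> = Re (stft_form rim (gauss_at 0) cross_probe)"
    using integral_Re[OF int[unfolded set_integrable_def]] by (simp add: stft_form_def set_lebesgue_integral_def)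
  also have "\<dots> \<le> cmod (stft_form rim (gauss_at 0) cross_probe)" by (rule complex_Re_le_cmod)
  also have "\<dots> = cmod (stft_form U (gauss_at 0) cross_probe)"
    by (simp only: stft_form_gauss_orthogonal(1)[OF cross_probe_L2 cross_probe_orthogonal])
  finally show ?thesis .
qed

lemma gauss_dist_lower_bound:
  assumes sym: "uminus ` U = U" and cone: "rim \<subseteq> double_cone" and f: "top_eigenfunction U f"
  shows "probe_constant / 24 * (1 - a) \<le> gauss_dist f"
  unfolding gauss_dist_def
proof (rule cInf_greatest)
  show "{l2_norm (\<lambda>t. f t - c * gauss_at z t) | z c. cmod c = 1} \<noteq> {}"
    using norm_one by blast
  fix r assume "r \<in> {l2_norm (\<lambda>t. f t - c * gauss_at z t) | z c. cmod c = 1}"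
  then obtain z c where r: "r = l2_norm (\<lambda>t. f t - c * gauss_at z t)" and c: "cmod c = 1" by blast
  show "probe_constant / 24 * (1 - a) \<le> r"
    using eigenfunction_distance[OF sym f cross_probe_L2 cross_probe_orthogonal cross_probe_norm c, of z]
      cross_probe_detects_rim[OF cone]
    unfolding r by simp
qed

end

section \<open>The lobed disc\<close>

lemma borel_double_cone [measurable]: "double_cone \<in> sets borel"
  unfolding double_cone_def by (intro borel_closed closed_Collect_le continuous_intros) auto

lemma scaleR_double_cone_area_disc:
  assumes "0 < r"
  shows "(*\<^sub>R) (sqrt r) ` (double_cone \<inter> area_disc 1) = double_cone \<inter> area_disc r"
proof (intro equalityI subsetI)
  fix z assume "z \<in> (*\<^sub>R) (sqrt r) ` (double_cone \<inter> area_disc 1)"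
  then obtain w where w: "w \<in> double_cone" "w \<in> area_disc 1" and z: "z = sqrt r *\<^sub>R w" by auto
  have "pi * (norm z)\<^sup>2 = r * (pi * (norm w)\<^sup>2)" using assms by (simp add: z power_mult_distrib)
  also have "\<dots> \<le> r * 1" using w assms by (intro mult_left_mono) (auto simp: area_disc_def)
  finally show "z \<in> double_cone \<inter> area_disc r"
    using w assms by (auto simp: z double_cone_def area_disc_def abs_mult mult_left_mono simp flip: times_divide_eq_right)
next
  fix z assume z: "z \<in> double_cone \<inter> area_disc r"
  define w where "w = (1 / sqrt r) *\<^sub>R z"
  have "pi * (norm w)\<^sup>2 = pi * (norm z)\<^sup>2 / r" using assms by (simp add: w_def power_mult_distrib power_divide)
  also have "\<dots> \<le> 1" using z assms by (simp add: area_disc_def)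
  finally have "w \<in> double_cone \<inter> area_disc 1"
    using z assms by (auto simp: w_def double_cone_def area_disc_def divide_right_mono)
  moreover have "z = sqrt r *\<^sub>R w" using assms by (simp add: w_def)
  ultimately show "z \<in> (*\<^sub>R) (sqrt r) ` (double_cone \<inter> area_disc 1)" by blast
qed

text \<open>
  An angular proportion, as the cone is homogeneous: it enters through scaling and through the
  strict bounds \<open>0\<close> and \<open>1\<close>.
\<close>

definition cone_fraction :: real where
  "cone_fraction = measure lborel (double_cone \<inter> area_disc 1)"

lemma fmeasurable_area_disc_subset:
  assumes "A \<in> sets borel" "A \<subseteq> area_disc r" "0 \<le> r"
  shows "A \<in> fmeasurable lborel"
  using assms emeasure_mono[of A "area_disc r" lborel]
  by (intro fmeasurableI) (auto simp: emeasure_area_disc order.strict_trans1)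

lemma measure_double_cone_area_disc:
  assumes "0 \<le> r" shows "measure lborel (double_cone \<inter> area_disc r) = cone_fraction * r"
proof (cases "r = 0")
  case True
  have "measure lborel (double_cone \<inter> area_disc 0) \<le> measure lborel (area_disc 0)"
    by (intro measure_mono_fmeasurable fmeasurable_area_disc_subset[of _ 0]) auto
  then have "measure lborel (double_cone \<inter> area_disc 0) = 0"
    using measure_area_disc[of 0] by (intro antisym) auto
  then show ?thesis using True by simp
next
  case False
  then have r: "0 < r" using assms by simp
  have "measure lebesgue ((\<lambda>x. sqrt r *\<^sub>R x + 0) ` (double_cone \<inter> area_disc 1))
      = \<bar>sqrt r\<bar> ^ DIM(real \<times> real) * measure lebesgue (double_cone \<inter> area_disc 1)"
    by (rule measure_lebesgue_affine)
  then show ?thesis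
    using r by (simp add: scaleR_double_cone_area_disc[OF r] cone_fraction_def mult.commute)
qed

lemma cone_fraction_bounds: "0 < cone_fraction" "cone_fraction < 1"
proof -
  have near: "\<bar>fst z - p\<bar> < 1 / 16 \<and> \<bar>snd z - q\<bar> < 1 / 16 \<and> norm z < norm (p, q) + 1 / 16"
    if "z \<in> ball (p, q) (1 / 16)" for z and p q :: real
  proof -
    have n: "norm (z - (p, q)) < 1 / 16" using that by (simp add: dist_norm norm_minus_commute)
    have "\<bar>fst (z - (p, q))\<bar> \<le> norm (z - (p, q))" "\<bar>snd (z - (p, q))\<bar> \<le> norm (z - (p, q))"
      using norm_fst_le[of "fst z - p" "snd z - q"] norm_snd_le[of "snd z - q" "fst z - p"]
      by (cases z; simp)+
    moreover have "norm z \<le> norm (p, q) + norm (z - (p, q))" by norm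
    ultimately show ?thesis using n by simp
  qed
  have small: "pi * n\<^sup>2 \<le> 1" if "0 \<le> n" "n < 1 / 4 + 1 / 16" for n :: real
  proof -
    have "n\<^sup>2 \<le> (5 / 16)\<^sup>2" using that by (intro power_mono) auto
    then have "pi * n\<^sup>2 \<le> 4 * (5 / 16)\<^sup>2" using pi_less_4 by (intro mult_mono) auto
    then show ?thesis by (simp add: power2_eq_square)
  qed
  (* a small disc inside the cone, and one outside it *)
  have b1: "ball (1 / 4, 0) (1 / 16) \<subseteq> double_cone \<inter> area_disc 1"
  proof
    fix z :: "real \<times> real" assume "z \<in> ball (1 / 4, 0) (1 / 16)"
    then have n: "\<bar>fst z - 1 / 4\<bar> < 1 / 16" "\<bar>snd z\<bar> < 1 / 16" "norm z < 1 / 4 + 1 / 16"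
      using near[of z "1/4" 0] by auto
    then have "\<bar>snd z\<bar> \<le> \<bar>fst z\<bar> / 2" by linarith
    then show "z \<in> double_cone \<inter> area_disc 1"
      using n small[of "norm z"] by (auto simp: double_cone_def area_disc_def)
  qed
  have b2: "ball (0, 1 / 4) (1 / 16) \<subseteq> area_disc 1 - double_cone"
  proof
    fix z :: "real \<times> real" assume "z \<in> ball (0, 1 / 4) (1 / 16)"
    then have n: "\<bar>fst z\<bar> < 1 / 16" "\<bar>snd z - 1 / 4\<bar> < 1 / 16" "norm z < 1 / 4 + 1 / 16"
      using near[of z 0 "1/4"] by auto
    then have "\<not> \<bar>snd z\<bar> \<le> \<bar>fst z\<bar> / 2" by linarith
    then show "z \<in> area_disc 1 - double_cone"
      using n small[of "norm z"] by (auto simp: double_cone_def area_disc_def)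
  qed
  have pos: "0 < measure lborel (ball p (1 / 16))" for p :: "real \<times> real"
    by (rule content_ball_pos) simp
  have "measure lborel (ball (1 / 4 :: real, 0 :: real) (1 / 16)) \<le> cone_fraction"
    unfolding cone_fraction_def using b1
    by (intro measure_mono_fmeasurable fmeasurable_area_disc_subset[of _ 1]) auto
  with pos show "0 < cone_fraction" by (rule less_le_trans)
  have "measure lborel (ball (0 :: real, 1 / 4 :: real) (1 / 16)) \<le> measure lborel (area_disc 1 - double_cone \<inter> area_disc 1)"
    using b2 by (intro measure_mono_fmeasurable fmeasurable_area_disc_subset[of _ 1]) auto
  also have "\<dots> = 1 - cone_fraction"
    by (subst measure_Diff) (auto simp: emeasure_area_disc measure_area_disc cone_fraction_def)
  finally show "cone_fraction < 1" using pos[of "(0, 1 / 4)"] by linarith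
qed

text \<open>
  The disc of area \<open>1\<close> is shrunk outside the double cone and enlarged inside it. The two areas are
  balanced so that the total area stays equal to \<open>1\<close> while the width of the rim is \<open>d\<close>.
\<close>

definition lobed_disc :: "real \<Rightarrow> (real \<times> real) set" where
  "lobed_disc d = area_disc (1 - cone_fraction * d) \<union> (double_cone \<inter> area_disc (1 + (1 - cone_fraction) * d))"

lemma near_disc_lobed_disc:
  assumes d: "0 < d" "d \<le> 1 / 10"
  shows "near_disc (lobed_disc d) (1 - cone_fraction * d) (1 + (1 - cone_fraction) * d)"
proof -
  let ?a = "1 - cone_fraction * d" and ?b = "1 + (1 - cone_fraction) * d"
  note \<theta> = cone_fraction_bounds
  have "cone_fraction * d \<le> 1 * d" using \<theta> d by (intro mult_right_mono) auto
  then have a: "0 \<le> ?a" using d by linarith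
  have ab: "?a \<le> ?b" using d by (simp add: algebra_simps)
  then have b: "0 \<le> ?b" using a by linarith
  have [measurable]: "lobed_disc d \<in> sets borel" unfolding lobed_disc_def by measurable
  have outer: "lobed_disc d \<subseteq> area_disc ?b" using area_disc_mono[OF ab] by (auto simp: lobed_disc_def)
  have fm: "lobed_disc d \<in> fmeasurable lborel"
    by (rule fmeasurable_area_disc_subset[OF _ outer b]) simp
  have "measure lborel (lobed_disc d) = measure lborel (area_disc ?a)
      + measure lborel (double_cone \<inter> area_disc ?b) - measure lborel (area_disc ?a \<inter> (double_cone \<inter> area_disc ?b))"
    unfolding lobed_disc_def
    by (intro measure_Un3 fmeasurable_area_disc_subset[OF _ order_refl a] fmeasurable_area_disc_subset[OF _ _ b]) auto
  (* with \<theta> = cone_fraction the total area is ?a + \<theta> (?b - ?a), and ?b - ?a = d *)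
  also have "area_disc ?a \<inter> (double_cone \<inter> area_disc ?b) = double_cone \<inter> area_disc ?a"
    using area_disc_mono[OF ab] by auto
  finally have m: "measure lborel (lobed_disc d) = 1"
    using a b by (simp add: measure_area_disc measure_double_cone_area_disc algebra_simps)
  show ?thesis
  proof
    show "emeasure lborel (lobed_disc d) < \<infinity>" using fm by (auto simp: fmeasurable_def)
    show "area_disc ?a \<subseteq> lobed_disc d" by (auto simp: lobed_disc_def)
    show "?b - ?a \<le> 1 / 10" using d by (simp add: algebra_simps)
  qed (use a outer m in auto)
qed

lemma admissible_lobed_disc:
  assumes "0 < d" "d \<le> 1 / 10"
  shows "admissible (lobed_disc d)" "measure lebesgue (lobed_disc d) = 1"
proof -
  interpret near_disc "lobed_disc d" "1 - cone_fraction * d" "1 + (1 - cone_fraction) * d"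
    by (rule near_disc_lobed_disc[OF assms])
  show m: "measure lebesgue (lobed_disc d) = 1" using unit_area by simp
  have "emeasure lebesgue (lobed_disc d) < \<infinity>" using finite_U by simp
  then have "lobed_disc d \<in> lmeasurable" by (intro fmeasurableI) auto
  then show "admissible (lobed_disc d)" by (simp add: admissible_def m)
qed

lemma abs_deficit_lobed_disc:
  assumes "0 < d" "d \<le> 1 / 10" shows "\<bar>deficit (lobed_disc d)\<bar> \<le> 10 * d\<^sup>2"
proof -
  interpret near_disc "lobed_disc d" "1 - cone_fraction * d" "1 + (1 - cone_fraction) * d"
    by (rule near_disc_lobed_disc[OF assms])
  show ?thesis using abs_deficit_le by (simp add: algebra_simps)
qed

lemma gauss_dist_lobed_disc:
  assumes "0 < d" "d \<le> 1 / 10" and f: "top_eigenfunction (lobed_disc d) f"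
  shows "probe_constant / 24 * cone_fraction * d \<le> gauss_dist f"
proof -
  interpret near_disc "lobed_disc d" "1 - cone_fraction * d" "1 + (1 - cone_fraction) * d"
    by (rule near_disc_lobed_disc[OF assms(1,2)])
  have "- z \<in> lobed_disc d \<longleftrightarrow> z \<in> lobed_disc d" for z
    by (simp add: lobed_disc_def area_disc_def double_cone_def)
  then have "z \<in> lobed_disc d \<longleftrightarrow> z \<in> uminus ` lobed_disc d" for z
    by (simp add: image_iff minus_equation_iff[of _ z] equation_minus_iff[of z])
  then have "uminus ` lobed_disc d = lobed_disc d" by blast
  moreover have "rim \<subseteq> double_cone" unfolding rim_def by (auto simp: lobed_disc_def)
  ultimately show ?thesis using gauss_dist_lower_bound[OF _ _ f] by (simp add: mult.assoc)
qed

text \<open>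
  The reflection \<open>z \<mapsto> - z\<close> exchanges the two closed half planes bounded by the line orthogonal to \<open>p\<close>.
\<close>

lemma measure_le_twice_half_plane:
  fixes T :: "(real \<times> real) set"
  assumes [measurable]: "T \<in> sets borel" and T: "T \<in> fmeasurable lborel"
    and sym: "\<And>z. z \<in> T \<Longrightarrow> - z \<in> T"
  shows "measure lborel T \<le> 2 * measure lborel {z \<in> T. z \<bullet> p \<le> 0}"
proof -
  let ?T1 = "{z \<in> T. z \<bullet> p \<le> 0}" and ?T2 = "{z \<in> T. 0 \<le> z \<bullet> p}"
  have half [measurable]: "{z. z \<bullet> p \<le> 0} \<in> sets borel" "{z. 0 \<le> z \<bullet> p} \<in> sets borel"
    by (intro borel_closed closed_Collect_le continuous_intros)+
  have T1: "?T1 = T \<inter> {z. z \<bullet> p \<le> 0}" and T2: "?T2 = T \<inter> {z. 0 \<le> z \<bullet> p}" by auto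
  have [measurable]: "?T1 \<in> sets borel" "?T2 \<in> sets borel" unfolding T1 T2 by measurable
  have fm: "?T1 \<in> fmeasurable lborel" "?T2 \<in> fmeasurable lborel"
    using T by (auto intro!: fmeasurableI2[OF T])
  have "emeasure (distr lborel borel uminus) ?T2 = emeasure lborel (uminus -` ?T2 \<inter> space lborel)"
    by (rule emeasure_distr) auto
  moreover have "uminus -` ?T2 \<inter> space lborel = ?T1"
  proof (intro set_eqI iffI)
    fix z assume "z \<in> uminus -` ?T2 \<inter> space lborel"
    then show "z \<in> ?T1" using sym[of "- z"] by simp
  next
    fix z assume "z \<in> ?T1"
    then show "z \<in> uminus -` ?T2 \<inter> space lborel" using sym[of z] by simp
  qed
  ultimately have "measure lborel ?T2 = measure lborel ?T1"
    by (simp add: lborel_distr_uminus_plane measure_def)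
  moreover have "measure lborel (?T1 \<union> ?T2) \<le> measure lborel ?T1 + measure lborel ?T2"
    by (rule measure_Un_le) auto
  moreover have "?T1 \<union> ?T2 = T" by auto
  ultimately show ?thesis by simp
qed

text \<open>
  A disc of area \<open>1\<close> centred at \<open>p\<close> contains no point \<open>z\<close> with \<open>z \<bullet> p \<le> 0\<close> and \<open>\<pi> \<bar>z\<bar>\<^sup>2 > 1\<close>. Hence, wherever
  it is placed, it misses at least half of the lobes that stick out of the centred disc of area \<open>1\<close>.
\<close>

lemma fraenkel_asymmetry_lobed_disc:
  assumes d: "0 < d" "d \<le> 1 / 10"
  shows "cone_fraction * (1 - cone_fraction) / 2 * d \<le> fraenkel_asymmetry (lobed_disc d)"
  unfolding fraenkel_asymmetry_def
proof (rule cInf_greatest)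
  let ?U = "lobed_disc d" and ?b = "1 + (1 - cone_fraction) * d"
  interpret near_disc ?U "1 - cone_fraction * d" ?b
    by (rule near_disc_lobed_disc[OF d])
  have m1: "measure lebesgue ?U = 1" by (rule admissible_lobed_disc(2)[OF d])
  have disc1: "area_disc 1 = cball 0 (sqrt (1 / pi))" by (rule area_disc_eq_cball) simp
  have "measure lebesgue (ball (0 :: real \<times> real) (sqrt (1 / pi))) = 1"
    by (simp add: content_ball unit_ball_vol_2 power_divide)
  then have "(\<exists>p r. ball (0 :: real \<times> real) (sqrt (1 / pi)) = ball p r)
      \<and> measure lebesgue (ball (0 :: real \<times> real) (sqrt (1 / pi))) = measure lebesgue ?U"
    using m1 by metis
  then show "{measure lebesgue (sym_diff ?U B) / measure lebesgue ?U | B.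
      (\<exists>p r. B = ball p r) \<and> measure lebesgue B = measure lebesgue ?U} \<noteq> {}"
    by blast
  fix s assume "s \<in> {measure lebesgue (sym_diff ?U B) / measure lebesgue ?U | B.
      (\<exists>p r. B = ball p r) \<and> measure lebesgue B = measure lebesgue ?U}"
  then obtain p r where s: "s = measure lebesgue (sym_diff ?U (ball p r))" and mB: "measure lebesgue (ball p r) = 1"
    using m1 by auto
  have "0 < r" using mB by (metis ball_eq_empty measure_empty not_less zero_neq_one)
  then have r: "pi * r\<^sup>2 = 1" using mB by (simp add: content_ball unit_ball_vol_2 power2_eq_square)
  let ?T = "double_cone \<inter> area_disc ?b - double_cone \<inter> area_disc 1"
  have b: "1 \<le> ?b" by (rule radii(2))
  have T: "?T \<in> fmeasurable lborel"
    by (rule fmeasurable_area_disc_subset[of _ ?b]) (use b in auto)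
  have "measure lborel ?T = cone_fraction * (1 - cone_fraction) * d"
    using b area_disc_mono[OF b] fmeasurable_area_disc_subset[of "double_cone \<inter> area_disc ?b" ?b]
    by (subst measure_Diff) (auto simp: measure_double_cone_area_disc fmeasurable_def algebra_simps)
  moreover have "?T \<in> sets borel" by measurable
  then have "measure lborel ?T \<le> 2 * measure lborel {z \<in> ?T. z \<bullet> p \<le> 0}"
    by (rule measure_le_twice_half_plane[OF _ T]) (auto simp: double_cone_def area_disc_def)
  moreover have "measure lborel {z \<in> ?T. z \<bullet> p \<le> 0} \<le> measure lborel (sym_diff ?U (ball p r))"
  proof (rule measure_mono_fmeasurable)
    show "{z \<in> ?T. z \<bullet> p \<le> 0} \<subseteq> sym_diff ?U (ball p r)"
    proof
      fix z assume z: "z \<in> {z \<in> ?T. z \<bullet> p \<le> 0}"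
      then have "z \<in> ?U" by (auto simp: lobed_disc_def)
      moreover have "z \<notin> ball p r"
      proof
        assume "z \<in> ball p r"
        then have "(norm (z - p))\<^sup>2 < r\<^sup>2"
          by (intro power_strict_mono) (auto simp: dist_norm norm_minus_commute)
        moreover have "(norm (z - p))\<^sup>2 = (norm z)\<^sup>2 - 2 * (z \<bullet> p) + (norm p)\<^sup>2"
          by (simp add: power2_norm_eq_inner inner_diff inner_commute)
        moreover have "z \<bullet> p \<le> 0" using z by simp
        ultimately have "(norm z)\<^sup>2 < r\<^sup>2" using zero_le_power2[of "norm p"] by linarith
        then have "pi * (norm z)\<^sup>2 < pi * r\<^sup>2" by simp
        then show False using z r by (auto simp: area_disc_def)
      qed
      ultimately show "z \<in> sym_diff ?U (ball p r)" by simp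
    qed
    have "{z. z \<bullet> p \<le> 0} \<in> sets borel" by (intro borel_closed closed_Collect_le continuous_intros)
    moreover have "{z \<in> ?T. z \<bullet> p \<le> 0} = ?T \<inter> {z. z \<bullet> p \<le> 0}" by auto
    ultimately show "{z \<in> ?T. z \<bullet> p \<le> 0} \<in> sets lborel" by simp
    have "?U \<in> fmeasurable lborel" "ball p r \<in> fmeasurable lborel"
      using finite_U by (auto intro!: fmeasurableI simp: emeasure_ball \<open>0 < r\<close> less_imp_le)
    then show "sym_diff ?U (ball p r) \<in> fmeasurable lborel" by (intro fmeasurable.Un fmeasurable.Diff)
  qed
  moreover have "s = measure lborel (sym_diff ?U (ball p r))" unfolding s by (rule measure_completion) simp
  ultimately show "cone_fraction * (1 - cone_fraction) / 2 * d \<le> s" by simp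
qed

section \<open>Optimality of the exponent\<close>

lemma no_superlinear_majorant:
  fixes k M p :: real
  assumes k: "0 < k" and p: "1 < p"
  obtains d where "0 < d" "d \<le> 1 / 10" "M * d powr p < k * d"
proof -
  (* solves (\<bar>M\<bar> + 1) e powr (p - 1) = k / 2 *)
  define e where "e = (k / (2 * (\<bar>M\<bar> + 1))) powr (1 / (p - 1))"
  define d where "d = min (1 / 10) e"
  have e: "0 < e" using k by (simp add: e_def)
  have d: "0 < d" "d \<le> 1 / 10" "d \<le> e" using e by (auto simp: d_def)
  have "e powr (p - 1) = k / (2 * (\<bar>M\<bar> + 1))"
    unfolding e_def using p k by (simp add: powr_powr)
  moreover have "d powr (p - 1) \<le> e powr (p - 1)" using d p by (intro powr_mono2) auto
  ultimately have dp: "d powr (p - 1) \<le> k / (2 * (\<bar>M\<bar> + 1))" by simp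
  have "M * d powr (p - 1) \<le> \<bar>M\<bar> * (k / (2 * (\<bar>M\<bar> + 1)))" using dp by (intro mult_mono) auto
  also have "\<dots> < k"
  proof -
    have "\<bar>M\<bar> * k < k * (2 * (\<bar>M\<bar> + 1))" using k by (simp add: algebra_simps add_nonneg_pos)
    then show ?thesis by (simp add: field_simps)
  qed
  finally have "(M * d powr (p - 1)) * d < k * d" using d by simp
  moreover have "d powr (p - 1) * d = d powr p"
    using d powr_add[of d "p - 1" 1] by simp
  ultimately show thesis using that d by (simp add: mult.assoc)
qed

lemma deficit_powr_lobed_disc:
  assumes d: "0 < d" "d \<le> 1 / 10" and \<beta>: "0 \<le> \<beta>"
  shows "deficit (lobed_disc d) powr \<beta> \<le> 10 powr \<beta> * d powr (2 * \<beta>)"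
proof -
  have "deficit (lobed_disc d) powr \<beta> = \<bar>deficit (lobed_disc d)\<bar> powr \<beta>"
    using uminus_powr_eq[of "deficit (lobed_disc d)" \<beta>] by (simp add: abs_if)
  also have "\<dots> \<le> (10 * d\<^sup>2) powr \<beta>"
    using abs_deficit_lobed_disc[OF d] \<beta> by (intro powr_mono2) auto
  also have "\<dots> = 10 powr \<beta> * d powr (2 * \<beta>)"
    using d by (simp add: powr_mult powr_powr flip: powr_numeral)
  finally show ?thesis .
qed

theorem theorem4:
  fixes \<beta> :: real
  assumes "\<beta> > 1/2"
  shows "(\<forall>F. (\<forall>U. admissible U \<longrightarrow> top_eigenfunction U (F U)) \<longrightarrow>
             \<not> (\<exists>C>0. eigenfunction_stability F C \<beta>)) \<and>
         \<not> (\<exists>K :: real \<Rightarrow> real. (\<forall>s>0. K s > 0) \<and> set_stability K \<beta>)"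
proof (intro conjI allI impI notI)
  fix F assume F: "\<forall>U. admissible U \<longrightarrow> top_eigenfunction U (F U)"
  assume "\<exists>C>0. eigenfunction_stability F C \<beta>"
  then obtain C where C: "0 < C" "eigenfunction_stability F C \<beta>" by blast
  have k: "0 < probe_constant / 24 * cone_fraction"
    using probe_constant_pos cone_fraction_bounds by simp
  obtain d where d: "0 < d" "d \<le> 1 / 10"
    and small: "(C * exp (1 / 2) * 10 powr \<beta>) * d powr (2 * \<beta>) < probe_constant / 24 * cone_fraction * d"
    using no_superlinear_majorant[OF k, of "2 * \<beta>"] assms by auto
  note adm = admissible_lobed_disc[OF d]
  have "probe_constant / 24 * cone_fraction * d \<le> gauss_dist (F (lobed_disc d))"
    using gauss_dist_lobed_disc[OF d] F adm by blast
  also have "\<dots> \<le> C * exp (1 / 2) * deficit (lobed_disc d) powr \<beta>"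
    using C adm unfolding eigenfunction_stability_def by metis
  also have "\<dots> \<le> C * exp (1 / 2) * (10 powr \<beta> * d powr (2 * \<beta>))"
    using deficit_powr_lobed_disc[OF d, of \<beta>] assms C by (intro mult_left_mono) auto
  finally show False using small by (simp add: mult.assoc)
next
  assume "\<exists>K :: real \<Rightarrow> real. (\<forall>s>0. K s > 0) \<and> set_stability K \<beta>"
  then obtain K :: "real \<Rightarrow> real" where "\<forall>s>0. K s > 0" and stab: "set_stability K \<beta>" by blast
  then have K: "K 1 > 0" "set_stability K \<beta>" by simp_all
  have k: "0 < cone_fraction * (1 - cone_fraction) / 2"
    using cone_fraction_bounds by simp
  obtain d where d: "0 < d" "d \<le> 1 / 10"
    and small: "(K 1 * 10 powr \<beta>) * d powr (2 * \<beta>) < cone_fraction * (1 - cone_fraction) / 2 * d"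
    using no_superlinear_majorant[OF k, of "2 * \<beta>"] assms by auto
  note adm = admissible_lobed_disc[OF d]
  have "cone_fraction * (1 - cone_fraction) / 2 * d \<le> fraenkel_asymmetry (lobed_disc d)"
    by (rule fraenkel_asymmetry_lobed_disc[OF d])
  also have "\<dots> \<le> K 1 * deficit (lobed_disc d) powr \<beta>"
    using K adm unfolding set_stability_def by metis
  also have "\<dots> \<le> K 1 * (10 powr \<beta> * d powr (2 * \<beta>))"
    using deficit_powr_lobed_disc[OF d, of \<beta>] assms K by (intro mult_left_mono) auto
  finally show False using small by (simp add: mult.assoc)
qed

end
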